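(* Let $(s_n)$ be a sequence of positive integers and let $(\epsilon_n)$ be a real sequence with $\epsilon_n\to 0$. Let $\Theta_n$ be a subset of $\{\theta\in\mathbb{R}^p: s_\theta\le s_n,\ \|\theta-\theta_0\|_1\le\epsilon_n\}$ and define $$r_n(\theta,\eta)=L_n(\theta,\eta)-L_n(\theta_0,\eta)-\sqrt n(\theta-\theta_0)^T\mathbb{G}_n\dot\ell_{\theta_0,\eta}+\frac n2(\theta-\theta_0)^TV_{n,\eta}(\theta-\theta_0).$$ Then $$\mathbb{E}\Big(\sup_{\theta\in\Theta_n}\sup_{\eta\in\mathcal{H}_0}|r_n(\theta,\eta)|\Big)\lesssim n\epsilon_n^2\delta_n+\epsilon_n\sup_{\theta\in\Theta_n}\|\mathbf{X}(\theta-\theta_0)\|_2^2,$$ where $\delta_n=\sqrt{s_n\log p/n}$.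
   Context: Model. For each sample size $n$, $Y_i=x_i^T\theta+\epsilon_i$, $i=1,\dots,n$, with nonrandom (fixed design) covariates $x_i=(x_{i1},\dots,x_{ip})^T\in\mathbb{R}^p$, $\theta\in\Theta=\mathbb{R}^p$ and i.i.d. errors $\epsilon_i$ with density $\eta$ on $\mathbb{R}$. The dimension $p=p_n$, the design and the true coefficient $\theta_0$ may depend on $n$ (suppressed in notation). The data are generated from the true pair $(\theta_0,\eta_0)$; $P_0=P_0^{(n)}$ is the law of the data under it and $\mathbb{E}$ the corresponding expectation. Standing assumptions: for fixed constants $\alpha,L>0$, $p\ge n^\alpha$ and $\sup_{i,j}|x_{ij}|\le L$; and $\eta_0\in\mathcal{H}_0$ (defined next). Class $\mathcal{H}_0$: fix $0<\sigma_1<\sigma_2$ and $M>0$. Let $\overline{\mathscr{M}}$ be the set of Borel probability measures $F$ on $[-M,M]\times[\sigma_1,\sigma_2]$ with $dF(z,\sigma)=dF(-z,\sigma)$ (invariance under $z\mapsto -z$). $\mathcal{H}_0$ is the set of densities $\eta(x)=\int\frac{1}{\sqrt{2\pi}\sigma}\exp\{-\frac{(x-z)^2}{2\sigma^2}\}\,dF(z,\sigma)$ with $F\in\overline{\mathscr{M}}$. Notation: $s_\theta=|\{i:\theta_i\ne0\}|$. $\ell_\eta=\log\eta$, $\dot\ell_\eta(y)=-\ell_\eta'(y)$, $\ell_{\theta,\eta}(x,y)=\ell_\eta(y-x^T\theta)$, $\dot\ell_{\theta,\eta}(x,y)=\dot\ell_\eta(y-x^T\theta)\,x$. $L_n(\theta,\eta)=\sum_{i=1}^n\ell_{\theta,\eta}(x_i,Y_i)$.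 $\mathbb{G}_nf=n^{-1/2}\sum_{i=1}^n\{f(x_i,Y_i)-\mathbb{E}f(x_i,Y_i)\}$. $\mathbf{X}=(x_{ij})\in\mathbb{R}^{n\times p}$ is the design matrix, $\Sigma=n^{-1}\mathbf{X}^T\mathbf{X}$, $v_\eta=\int\dot\ell_\eta\,\dot\ell_{\eta_0}\,\eta_0\,dy$, $V_{n,\eta}=v_\eta\Sigma$. $a\lesssim b$ means $a\le Cb$ for a constant $C$ that is universal or depends only on $M,L,\sigma_1,\sigma_2,\alpha$.
   Formalization: The bound is stated for every n ≥ 1 with p ≥ 2 (automatic for n ≥ 2 since p ≥ n^α); only n = 1, p = 1 is excluded, where log p = 0, δ_n = 0 and the claimed inequality fails as ε_1 tends to 0. *)

theory Defs
  imports "HOL-Probability.Probability" "Jordan_Normal_Form.Matrix"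
begin

no_notation inner (infix "\<bullet>" 70)
no_notation Finite_Cartesian_Product.vec_nth (infixl "$" 90)

text \<open>
  Vectors of \<open>R\<^sup>p\<close> and \<open>n \<times> p\<close> design matrices are taken in the carriers
  \<^term>\<open>carrier_vec p\<close> and \<^term>\<open>carrier_mat n p\<close>, so that \<open>p\<close> may vary with \<open>n\<close>.
  The sample size and the dimension are read off the design matrix \<open>X\<close>, whose \<open>i\<close>-th row is
  the covariate \<open>x\<^sub>i\<close>; indices start at 0.
\<close>

definition sym_mixing :: "real \<Rightarrow> real \<Rightarrow> real \<Rightarrow> (real \<times> real) measure set" where
  "sym_mixing M \<sigma>1 \<sigma>2 =
    {F. prob_space F \<and> sets F = sets (restrict_space borel ({-M..M} \<times> {\<sigma>1..\<sigma>2})) \<and>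
        distr F F (\<lambda>(z, \<sigma>). (- z, \<sigma>)) = F}"

definition mixture_density :: "(real \<times> real) measure \<Rightarrow> real \<Rightarrow> real" where
  "mixture_density F x = (\<integral>(z, \<sigma>). normal_density z \<sigma> x \<partial>F)"

definition mixture_class :: "real \<Rightarrow> real \<Rightarrow> real \<Rightarrow> (real \<Rightarrow> real) set" where
  "mixture_class M \<sigma>1 \<sigma>2 = mixture_density ` sym_mixing M \<sigma>1 \<sigma>2"

definition sparsity :: "real vec \<Rightarrow> nat" where
  "sparsity \<theta> = card {j. j < dim_vec \<theta> \<and> \<theta> $ j \<noteq> 0}"

definition l1_norm :: "real vec \<Rightarrow> real" where
  "l1_norm v = (\<Sum>j<dim_vec v. \<bar>v $ j\<bar>)"

definition l2_norm :: "real vec \<Rightarrow> real" where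
  "l2_norm v = sqrt (scalar_prod v v)"

text \<open>
  Data are functions \<open>Y\<close> on \<open>{..<n}\<close>. Their law is that of \<open>Y\<^sub>i = x\<^sub>i\<^sup>T \<theta> + e\<^sub>i\<close>, where the
  \<open>e\<^sub>i\<close> are the coordinates of a point drawn from the \<open>n\<close>-fold product of \<open>\<eta>(y) dy\<close>.
\<close>

definition error_law :: "(real \<Rightarrow> real) \<Rightarrow> real measure" where
  "error_law \<eta> = density lborel (\<lambda>y. ennreal (\<eta> y))"

definition data_law :: "real mat \<Rightarrow> real vec \<Rightarrow> (real \<Rightarrow> real) \<Rightarrow> (nat \<Rightarrow> real) measure" where
  "data_law X \<theta> \<eta> =
    distr (PiM {..<dim_row X} (\<lambda>_. error_law \<eta>)) (PiM {..<dim_row X} (\<lambda>_. borel))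
      (\<lambda>e. \<lambda>i\<in>{..<dim_row X}. scalar_prod (row X i) \<theta> + e i)"

definition ell :: "(real \<Rightarrow> real) \<Rightarrow> real \<Rightarrow> real" where
  "ell \<eta> y = ln (\<eta> y)"

definition ell_dot :: "(real \<Rightarrow> real) \<Rightarrow> real \<Rightarrow> real" where
  "ell_dot \<eta> y = - deriv (ell \<eta>) y"

definition loglik :: "real vec \<Rightarrow> (real \<Rightarrow> real) \<Rightarrow> real vec \<Rightarrow> real \<Rightarrow> real" where
  "loglik \<theta> \<eta> x y = ell \<eta> (y - scalar_prod x \<theta>)"

definition score :: "real vec \<Rightarrow> (real \<Rightarrow> real) \<Rightarrow> real vec \<Rightarrow> real \<Rightarrow> real vec" where
  "score \<theta> \<eta> x y = ell_dot \<eta> (y - scalar_prod x \<theta>) \<cdot>\<^sub>v x"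

definition total_loglik ::
  "real mat \<Rightarrow> (nat \<Rightarrow> real) \<Rightarrow> real vec \<Rightarrow> (real \<Rightarrow> real) \<Rightarrow> real" where
  "total_loglik X Y \<theta> \<eta> = (\<Sum>i<dim_row X. loglik \<theta> \<eta> (row X i) (Y i))"

text \<open>
  \<open>P0\<close> is the law of the data, with respect to which the expectations are taken. The process is
  extended to vector-valued functions componentwise.
\<close>

definition emp_proc ::
  "real mat \<Rightarrow> (nat \<Rightarrow> real) measure \<Rightarrow> (real vec \<Rightarrow> real \<Rightarrow> real) \<Rightarrow> (nat \<Rightarrow> real) \<Rightarrow> real" where
  "emp_proc X P0 f Y =
    1 / sqrt (real (dim_row X)) *
      (\<Sum>i<dim_row X. f (row X i) (Y i) - (\<integral>Y'. f (row X i) (Y' i) \<partial>P0))"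

definition emp_proc_vec ::
  "real mat \<Rightarrow> (nat \<Rightarrow> real) measure \<Rightarrow> (real vec \<Rightarrow> real \<Rightarrow> real vec) \<Rightarrow> (nat \<Rightarrow> real) \<Rightarrow> real vec"
  where
  "emp_proc_vec X P0 f Y = vec (dim_col X) (\<lambda>j. emp_proc X P0 (\<lambda>x y. f x y $ j) Y)"

definition gram :: "real mat \<Rightarrow> real mat" where
  "gram X = (1 / real (dim_row X)) \<cdot>\<^sub>m (transpose_mat X * X)"

definition info :: "(real \<Rightarrow> real) \<Rightarrow> (real \<Rightarrow> real) \<Rightarrow> real" where
  "info \<eta>0 \<eta> = (\<integral>y. ell_dot \<eta> y * ell_dot \<eta>0 y * \<eta>0 y \<partial>lborel)"

definition info_mat :: "real mat \<Rightarrow> (real \<Rightarrow> real) \<Rightarrow> (real \<Rightarrow> real) \<Rightarrow> real mat" where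
  "info_mat X \<eta>0 \<eta> = info \<eta>0 \<eta> \<cdot>\<^sub>m gram X"

definition LAN_remainder ::
  "real mat \<Rightarrow> real vec \<Rightarrow> (real \<Rightarrow> real) \<Rightarrow> (nat \<Rightarrow> real) \<Rightarrow> real vec \<Rightarrow> (real \<Rightarrow> real) \<Rightarrow> real" where
  "LAN_remainder X \<theta>0 \<eta>0 Y \<theta> \<eta> =
    total_loglik X Y \<theta> \<eta> - total_loglik X Y \<theta>0 \<eta>
    - sqrt (real (dim_row X)) *
        scalar_prod (\<theta> - \<theta>0) (emp_proc_vec X (data_law X \<theta>0 \<eta>0) (score \<theta>0 \<eta>) Y)
    + real (dim_row X) / 2 * scalar_prod (\<theta> - \<theta>0) (info_mat X \<eta>0 \<eta> *\<^sub>v (\<theta> - \<theta>0))"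

definition rate :: "nat \<Rightarrow> nat \<Rightarrow> nat \<Rightarrow> real" where
  "rate n p s = sqrt (real s * ln (real p) / real n)"

end

theory Submission
  imports Defs "HOL-Real_Asymp.Real_Asymp"
begin

text \<open>
  Write \<open>e\<^sub>i = Y\<^sub>i - x\<^sub>i\<^sup>T \<theta>\<^sub>0\<close> for the errors and \<open>h\<^sub>i = x\<^sub>i\<^sup>T (\<theta> - \<theta>\<^sub>0)\<close>, so that \<open>\<bar>h\<^sub>i\<bar> \<le> L \<epsilon>\<close>. Expanding
  \<open>\<ell> (e\<^sub>i - h\<^sub>i)\<close> to second order, where \<open>\<ell> = ln \<eta>\<close>, the linear term is the score term: its mean is
  zero because the derivative of \<open>\<ell>\<close> is odd and the true error density is even. By integration by
  parts the quadratic term has mean \<open>- v\<^sub>\<eta> \<Sum> h\<^sub>i\<^sup>2 / 2\<close>. The remainder is therefore half of the centred sum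
  \<open>\<Sum> h\<^sub>i\<^sup>2 (\<ell>'' (e\<^sub>i) - E \<ell>'' (e\<^sub>i))\<close> plus third-order terms. Lemma \<open>LAN_remainder_eq\<close> records this.

  Mixtures of normal densities with bounded means and scales bounded away from zero have log-densities
  whose \<open>k\<close>-th derivative, for \<open>k = 1, 2, 3\<close>, is at most a constant times \<open>(1 + \<bar>x\<bar>)\<^sup>k\<close> in absolute value,
  with a constant common to the class (\<open>mixture_class_tame\<close>). Hence the third-order terms are at most a constant times
  \<open>min 1 \<bar>h\<^sub>i\<bar> h\<^sub>i\<^sup>2 (1 + e\<^sub>i\<^sup>2)\<^sup>2\<close>, for every size of \<open>h\<^sub>i\<close> (\<open>log_density_taylor\<close>). The mean of their sum is
  of order \<open>\<epsilon> \<parallel>X (\<theta> - \<theta>\<^sub>0)\<parallel>\<^sup>2\<close>, and what is left is again a centred sum weighted by the \<open>h\<^sub>i\<^sup>2\<close>.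

  Two observations make these centred sums uniform in \<open>\<theta>\<close> and \<open>\<eta>\<close>. First, \<open>h\<^sub>i\<^sup>2\<close> is a quadratic form in
  \<open>\<theta> - \<theta>\<^sub>0\<close>, whose \<open>l\<^sub>1\<close> norm is at most \<open>\<epsilon>\<close>; this costs \<open>\<epsilon>\<^sup>2\<close> and a maximum over the \<open>p\<^sup>2\<close> weight vectors
  \<open>x\<^sub>i\<^sub>j x\<^sub>i\<^sub>k\<close> (\<open>quadratic_form_le_sup\<close>). Second, a function \<open>f\<close> is \<open>f 0\<close> plus an integral of its
  derivative against indicators of half-lines. If \<open>\<bar>f'\<bar>\<close> is at most \<open>(1 + t\<^sup>2)\<^sup>2\<close>, a centred sum of \<open>f\<close> is in
  absolute value at most the integral over \<open>t\<close> of \<open>(1 + t\<^sup>2)\<^sup>2\<close> times the absolute centred sum of the indicator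
  of the half-line beyond \<open>t\<close>. The class of functions has disappeared from this bound, which takes the place of an
  entropy and chaining argument (\<open>centered_sum_le_tail_deviation\<close>).

  For one half-line \<open>A\<close> the maximum over \<open>N\<close> weight vectors has expectation at most of order
  \<open>sqrt (n P(A) ln N)\<close> (\<open>maximal_inequality_indicators\<close>). The factor \<open>sqrt (P(A))\<close> decays fast enough in \<open>t\<close>
  for the integral to converge (\<open>expected_sup_deviation\<close>), and \<open>N = p\<^sup>2\<close> yields
  \<open>\<epsilon>\<^sup>2 sqrt (n ln p) \<le> n \<epsilon>\<^sup>2 \<delta>\<^sub>n\<close>.
\<close>

section \<open>Differentiating Gaussian mixtures\<close>

text \<open>
  Dominated convergence for the difference quotients, which the mean value theorem dominates by a
  bound for the derivative near \<open>x\<close>. The bound is asked for only within distance 1 of \<open>x\<close>, so it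
  may grow polynomially in \<open>x\<close>.
\<close>

lemma has_real_derivative_lebesgue_integral:
  fixes f f' :: "'a \<Rightarrow> real \<Rightarrow> real"
  assumes "finite_measure F"
    and der: "\<And>s x. s \<in> space F \<Longrightarrow> (f s has_real_derivative f' s x) (at x)"
    and int: "\<And>x. integrable F (\<lambda>s. f s x)"
    and meas: "(\<lambda>s. f' s x) \<in> borel_measurable F"
    and bound: "\<And>s y. s \<in> space F \<Longrightarrow> \<bar>y - x\<bar> \<le> 1 \<Longrightarrow> \<bar>f' s y\<bar> \<le> B"
  shows "((\<lambda>y. \<integral>s. f s y \<partial>F) has_real_derivative (\<integral>s. f' s x \<partial>F)) (at x)"
proof -
  interpret finite_measure F by fact
  let ?q = "\<lambda>h s. (f s (x + h) - f s x) / h"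
  have "((\<lambda>h. \<integral>s. ?q h s \<partial>F) \<longlongrightarrow> (\<integral>s. f' s x \<partial>F)) (at 0)"
    unfolding tendsto_at_iff_sequentially
  proof (intro allI impI, unfold comp_def)
    fix h :: "nat \<Rightarrow> real"
    assume h: "\<forall>i. h i \<in> UNIV - {0}" "h \<longlonglongrightarrow> 0"
    have "\<forall>\<^sub>F i in sequentially. \<bar>h i\<bar> < 1"
      using order_tendstoD(2)[OF tendsto_rabs_zero[OF h(2)], of 1] by simp
    then obtain N where N: "\<And>i. i \<ge> N \<Longrightarrow> \<bar>h i\<bar> \<le> 1"
      by (auto simp: eventually_sequentially intro: less_imp_le)
    have "(\<lambda>i. \<integral>s. ?q (h (i + N)) s \<partial>F) \<longlonglongrightarrow> (\<integral>s. f' s x \<partial>F)"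
    proof (rule integral_dominated_convergence[where w="\<lambda>_. B"])
      show "(\<lambda>s. f' s x) \<in> borel_measurable F" by fact
      show "?q (h (i + N)) \<in> borel_measurable F" for i
        using int[THEN borel_measurable_integrable] by measurable
      have lim: "(\<lambda>i. ?q (h i) s) \<longlonglongrightarrow> f' s x" if "s \<in> space F" for s
        using der[OF that, of x] h
        unfolding DERIV_def tendsto_at_iff_sequentially comp_def by blast
      show "AE s in F. (\<lambda>i. ?q (h (i + N)) s) \<longlonglongrightarrow> f' s x"
        by (intro AE_I2 LIMSEQ_ignore_initial_segment lim)
      show "AE s in F. norm (?q (h (i + N)) s) \<le> B" for i
      proof (intro AE_I2)
        fix s assume s: "s \<in> space F"
        let ?h = "h (i + N)"
        have hh: "?h \<noteq> 0" "\<bar>?h\<bar> \<le> 1" using h(1) N[of "i + N"] by auto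
        have "\<bar>f s (x + ?h) - f s x\<bar> \<le> B * \<bar>(x + ?h) - x\<bar>"
          unfolding real_norm_def[symmetric]
          by (rule field_differentiable_bound[where S="{x-1..x+1}" and f'="f' s"])
             (use bound[OF s] hh(2) in \<open>auto intro!: DERIV_subset[OF der[OF s]] simp: abs_le_iff\<close>)
        then show "norm (?q ?h s) \<le> B" using hh by (simp add: divide_simps)
      qed
    qed simp
    then show "(\<lambda>i. \<integral>s. ?q (h i) s \<partial>F) \<longlonglongrightarrow> (\<integral>s. f' s x \<partial>F)"
      by (rule LIMSEQ_offset)
  qed
  moreover have "(\<integral>s. ?q h s \<partial>F) = ((\<integral>s. f s (x + h) \<partial>F) - (\<integral>s. f s x \<partial>F)) / h" for h
    using int by simp
  ultimately show ?thesis unfolding DERIV_def by (simp only:)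
qed

text \<open>
  The ratio of the \<open>k\<close>-th derivative of a normal density to the density itself: up to sign and scaling
  a Hermite polynomial, given by its three-term recursion.
\<close>

fun hermite_ratio :: "nat \<Rightarrow> real \<Rightarrow> real \<Rightarrow> real \<Rightarrow> real" where
  "hermite_ratio 0 z \<sigma> x = 1"
| "hermite_ratio (Suc 0) z \<sigma> x = (z - x) / \<sigma>\<^sup>2"
| "hermite_ratio (Suc (Suc k)) z \<sigma> x =
     (z - x) / \<sigma>\<^sup>2 * hermite_ratio (Suc k) z \<sigma> x - real (Suc k) / \<sigma>\<^sup>2 * hermite_ratio k z \<sigma> x"

text \<open>
  The Appell property of the Hermite polynomials; together with the recursion it makes the step from
  \<open>k\<close> to \<open>k + 1\<close> a single application of the product rule.
\<close>

lemma has_real_derivative_hermite_ratio: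
  "(hermite_ratio (Suc k) z \<sigma> has_real_derivative
     - (real (Suc k) / \<sigma>\<^sup>2) * hermite_ratio k z \<sigma> x) (at x)"
proof (induction k rule: induct_nat_012)
  case 0
  have "((\<lambda>x. (z - x) / \<sigma>\<^sup>2) has_real_derivative - (1 / \<sigma>\<^sup>2)) (at x)"
    by (auto intro!: derivative_eq_intros simp: divide_inverse)
  then show ?case by (simp add: fun_eq_iff)
next
  case 1
  have "((\<lambda>x. (z - x) / \<sigma>\<^sup>2 * ((z - x) / \<sigma>\<^sup>2) - 1 / \<sigma>\<^sup>2) has_real_derivative
      - (2 / \<sigma>\<^sup>2) * ((z - x) / \<sigma>\<^sup>2)) (at x)"
    by (auto intro!: derivative_eq_intros simp: divide_inverse algebra_simps)
  then show ?case by (simp add: fun_eq_iff)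
next
  case (ge2 k)
  have "((\<lambda>x. (z - x) / \<sigma>\<^sup>2) has_real_derivative - (1 / \<sigma>\<^sup>2)) (at x)"
    by (auto intro!: derivative_eq_intros simp: divide_inverse)
  from DERIV_diff[OF DERIV_mult[OF this ge2(2)] DERIV_cmult[OF ge2(1)]]
  show ?case
    unfolding hermite_ratio.simps(3)[of "Suc k", abs_def]
    by (rule DERIV_cong) (simp add: divide_inverse algebra_simps)
qed

lemma has_real_derivative_hermite_ratio_normal:
  assumes "\<sigma> > 0"
  shows "((\<lambda>x. hermite_ratio k z \<sigma> x * normal_density z \<sigma> x) has_real_derivative
     hermite_ratio (Suc k) z \<sigma> x * normal_density z \<sigma> x) (at x)"
proof -
  have nd: "(normal_density z \<sigma> has_real_derivative (z - x) / \<sigma>\<^sup>2 * normal_density z \<sigma> x) (at x)"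
  proof -
    have "((\<lambda>x. - (x - z)\<^sup>2 / (2 * \<sigma>\<^sup>2)) has_real_derivative - (2 * (x - z)) / (2 * \<sigma>\<^sup>2)) (at x)"
      by (rule DERIV_cdivide) (auto intro!: derivative_eq_intros)
    also have "- (2 * (x - z)) / (2 * \<sigma>\<^sup>2) = (z - x) / \<sigma>\<^sup>2"
      using assms by (simp add: field_simps)
    finally have "((\<lambda>x. c * exp (- (x - z)\<^sup>2 / (2 * \<sigma>\<^sup>2))) has_real_derivative
        c * (exp (- (x - z)\<^sup>2 / (2 * \<sigma>\<^sup>2)) * ((z - x) / \<sigma>\<^sup>2))) (at x)" for c
      by (intro DERIV_cmult DERIV_fun_exp)
    then have "((\<lambda>x. c * exp (- (x - z)\<^sup>2 / (2 * \<sigma>\<^sup>2))) has_real_derivative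
        (z - x) / \<sigma>\<^sup>2 * (c * exp (- (x - z)\<^sup>2 / (2 * \<sigma>\<^sup>2)))) (at x)" for c
      by (simp only: mult.left_commute mult.commute)
    then show ?thesis unfolding normal_density_def[abs_def] .
  qed
  show ?thesis
  proof (cases k)
    case 0
    then show ?thesis using nd by simp
  next
    case (Suc j)
    show ?thesis unfolding Suc
      using DERIV_mult[OF has_real_derivative_hermite_ratio[of j z \<sigma> x] nd]
      by (rule DERIV_cong) (simp add: algebra_simps)
  qed
qed

text \<open>
  The constant serves all means in \<open>[- M, M]\<close> and all scales above \<open>\<sigma>1\<close> at once, which is what makes the
  later bounds uniform over the mixture class. In the recursion each factor \<open>(z - x) / \<sigma>\<^sup>2\<close> costs one
  power of \<open>1 + \<bar>x\<bar>\<close>.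
\<close>

lemma hermite_ratio_bound:
  assumes "0 < \<sigma>1"
  shows "\<exists>c\<ge>0. \<forall>\<sigma>\<ge>\<sigma>1. \<forall>z. \<bar>z\<bar> \<le> M \<longrightarrow> (\<forall>x. \<bar>hermite_ratio k z \<sigma> x\<bar> \<le> c * (1 + \<bar>x\<bar>) ^ k)"
proof (cases "M \<ge> 0")
  case False
  then show ?thesis by (intro exI[of _ 0]) auto
next
  case True
  define r where "r = (1 + M) / \<sigma>1\<^sup>2"
  have q: "1 / \<sigma>\<^sup>2 \<le> 1 / \<sigma>1\<^sup>2" if "\<sigma> \<ge> \<sigma>1" for \<sigma>
    using that assms by (intro divide_left_mono power_mono) auto
  have lin: "\<bar>(z - x) / \<sigma>\<^sup>2\<bar> \<le> r * (1 + \<bar>x\<bar>)" if "\<sigma> \<ge> \<sigma>1" "\<bar>z\<bar> \<le> M" for \<sigma> z x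
  proof -
    have "\<bar>z - x\<bar> \<le> (1 + M) * (1 + \<bar>x\<bar>)"
    proof -
      have "\<bar>z - x\<bar> \<le> M + \<bar>x\<bar>" using that by linarith
      also have "\<dots> \<le> (1 + M) * (1 + \<bar>x\<bar>)" using True by (simp add: distrib_left distrib_right)
      finally show ?thesis .
    qed
    then have "\<bar>z - x\<bar> * (1 / \<sigma>\<^sup>2) \<le> (1 + M) * (1 + \<bar>x\<bar>) * (1 / \<sigma>1\<^sup>2)"
      using q[OF that(1)] True by (intro mult_mono) auto
    then show ?thesis by (simp add: r_def abs_divide)
  qed
  have r0: "r \<ge> 0" using True by (simp add: r_def)
  show ?thesis
  proof (induction k rule: induct_nat_012)
    case 0
    show ?case by (rule exI[of _ 1]) simp
  next
    case 1
    show ?case using lin r0 by (intro exI[of _ r]) auto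
  next
    case (ge2 k)
    from ge2(1) obtain a where
      a: "a \<ge> 0" "\<And>\<sigma> z x. \<sigma> \<ge> \<sigma>1 \<Longrightarrow> \<bar>z\<bar> \<le> M \<Longrightarrow> \<bar>hermite_ratio k z \<sigma> x\<bar> \<le> a * (1 + \<bar>x\<bar>) ^ k"
      by metis
    from ge2(2) obtain b where
      b: "b \<ge> 0" "\<And>\<sigma> z x. \<sigma> \<ge> \<sigma>1 \<Longrightarrow> \<bar>z\<bar> \<le> M \<Longrightarrow>
            \<bar>hermite_ratio (Suc k) z \<sigma> x\<bar> \<le> b * (1 + \<bar>x\<bar>) ^ Suc k"
      by metis
    define c where "c = r * b + real (Suc k) / \<sigma>1\<^sup>2 * a"
    have c0: "c \<ge> 0" using r0 a b by (simp add: c_def)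
    have "\<bar>hermite_ratio (Suc (Suc k)) z \<sigma> x\<bar> \<le> c * (1 + \<bar>x\<bar>) ^ Suc (Suc k)"
      if *: "\<sigma> \<ge> \<sigma>1" "\<bar>z\<bar> \<le> M" for \<sigma> z x
    proof -
      let ?y = "1 + \<bar>x\<bar>" and ?w = "\<bar>hermite_ratio k z \<sigma> x\<bar>"
      have 1: "\<bar>(z - x) / \<sigma>\<^sup>2\<bar> * \<bar>hermite_ratio (Suc k) z \<sigma> x\<bar> \<le> (r * ?y) * (b * ?y ^ Suc k)"
        using r0 by (intro mult_mono lin b(2) *) simp_all
      have "?y ^ k \<le> ?y ^ Suc (Suc k)"
        by (rule power_increasing) auto
      then have "?w \<le> a * ?y ^ Suc (Suc k)"
        using a(2)[OF *, of x] mult_left_mono[OF _ a(1)] by (meson order_trans)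
      moreover have "real (Suc k) * (1 / \<sigma>\<^sup>2) \<le> real (Suc k) * (1 / \<sigma>1\<^sup>2)"
        using q[OF *(1)] by (rule mult_left_mono) simp
      ultimately have 2: "(real (Suc k) * (1 / \<sigma>\<^sup>2)) * ?w \<le> (real (Suc k) * (1 / \<sigma>1\<^sup>2)) * (a * ?y ^ Suc (Suc k))"
        using a(1) by (intro mult_mono) (simp_all del: power_Suc times_divide_eq_right)
      have "\<bar>hermite_ratio (Suc (Suc k)) z \<sigma> x\<bar> \<le>
         \<bar>(z - x) / \<sigma>\<^sup>2 * hermite_ratio (Suc k) z \<sigma> x\<bar> + \<bar>real (Suc k) / \<sigma>\<^sup>2 * hermite_ratio k z \<sigma> x\<bar>"
        unfolding hermite_ratio.simps(3) by (rule abs_triangle_ineq4)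
      also have "\<dots> = \<bar>(z - x) / \<sigma>\<^sup>2\<bar> * \<bar>hermite_ratio (Suc k) z \<sigma> x\<bar> + (real (Suc k) * (1 / \<sigma>\<^sup>2)) * ?w"
        by (simp add: abs_mult)
      also have "\<dots> \<le> (r * ?y) * (b * ?y ^ Suc k) + (real (Suc k) * (1 / \<sigma>1\<^sup>2)) * (a * ?y ^ Suc (Suc k))"
        using 1 2 by (rule add_mono)
      also have "\<dots> = c * ?y ^ Suc (Suc k)"
        by (simp add: c_def algebra_simps)
      finally show ?thesis .
    qed
    then show ?case using c0 by (intro exI[of _ c]) simp
  qed
qed

definition mixture_deriv :: "nat \<Rightarrow> (real \<times> real) measure \<Rightarrow> real \<Rightarrow> real" where
  "mixture_deriv k F x = (\<integral>(z, \<sigma>). hermite_ratio k z \<sigma> x * normal_density z \<sigma> x \<partial>F)"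

lemma mixture_deriv_0: "mixture_deriv 0 F = mixture_density F"
  by (simp add: fun_eq_iff mixture_deriv_def mixture_density_def)

lemma borel_measurable_hermite_ratio:
  "(\<lambda>(z, \<sigma>). hermite_ratio k z \<sigma> x) \<in> borel_measurable borel"
proof (induction k rule: induct_nat_012)
  case 0
  show ?case by simp
next
  case 1
  show ?case unfolding hermite_ratio.simps split_beta' borel_prod[symmetric] by measurable
next
  case (ge2 k)
  note [measurable] = ge2[unfolded split_beta' borel_prod[symmetric]]
  show ?case unfolding hermite_ratio.simps split_beta' borel_prod[symmetric] by measurable
qed

lemma normal_density_le:
  assumes "0 < \<sigma>1" "\<sigma>1 \<le> \<sigma>"
  shows "normal_density z \<sigma> x \<le> 1 / \<sigma>1 * exp (- (x - z)\<^sup>2 / (2 * \<sigma>\<^sup>2))"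
proof -
  have "1 * \<sigma>\<^sup>2 \<le> (2 * pi) * \<sigma>\<^sup>2" using pi_gt3 by (intro mult_right_mono) auto
  then have "\<sigma> \<le> sqrt (2 * pi * \<sigma>\<^sup>2)"
    by (intro real_le_rsqrt) simp
  then have "1 / sqrt (2 * pi * \<sigma>\<^sup>2) \<le> 1 / \<sigma>1"
    using assms by (intro divide_left_mono mult_pos_pos) auto
  then show ?thesis
    unfolding normal_density_def by (intro mult_right_mono) auto
qed

locale gaussian_mixture =
  fixes M \<sigma>1 \<sigma>2 :: real and F :: "(real \<times> real) measure"
  assumes sigma1_pos: "0 < \<sigma>1" and mixing: "F \<in> sym_mixing M \<sigma>1 \<sigma>2"
begin

sublocale prob_space F
  using mixing by (simp add: sym_mixing_def)

lemma sets_mixing: "sets F = sets (restrict_space borel ({-M..M} \<times> {\<sigma>1..\<sigma>2}))"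
  using mixing by (simp add: sym_mixing_def)

lemma space_mixing: "space F = {-M..M} \<times> {\<sigma>1..\<sigma>2}"
  using sets_eq_imp_space_eq[OF sets_mixing] by (simp add: space_restrict_space)

lemma measurable_mixing: "f \<in> borel_measurable borel \<Longrightarrow> f \<in> borel_measurable F"
  using measurable_cong_sets[OF sets_mixing refl, of borel] measurable_restrict_space1 by blast

lemma measurable_integrand:
  "(\<lambda>(z, \<sigma>). hermite_ratio k z \<sigma> x * normal_density z \<sigma> x) \<in> borel_measurable F"
proof (rule measurable_mixing)
  have "(\<lambda>(z, \<sigma>). normal_density z \<sigma> x) \<in> borel_measurable borel"
    unfolding normal_density_def split_beta' borel_prod[symmetric] by measurable
  then show "(\<lambda>(z, \<sigma>). hermite_ratio k z \<sigma> x * normal_density z \<sigma> x) \<in> borel_measurable borel"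
    using borel_measurable_hermite_ratio[of k x] by (simp add: split_beta')
qed

lemma integrand_bound:
  assumes "s \<in> space F" "c \<ge> 0"
    and "\<And>\<sigma> z x. \<sigma>1 \<le> \<sigma> \<Longrightarrow> \<bar>z\<bar> \<le> M \<Longrightarrow> \<bar>hermite_ratio k z \<sigma> x\<bar> \<le> c * (1 + \<bar>x\<bar>) ^ k"
  shows "\<bar>case s of (z, \<sigma>) \<Rightarrow> hermite_ratio k z \<sigma> x * normal_density z \<sigma> x\<bar>
     \<le> c * (1 + \<bar>x\<bar>) ^ k * (case s of (z, \<sigma>) \<Rightarrow> normal_density z \<sigma> x)"
    and "(case s of (z, \<sigma>) \<Rightarrow> normal_density z \<sigma> x) \<le> 1 / \<sigma>1"
proof -
  obtain z \<sigma> where s: "s = (z, \<sigma>)" by fastforce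
  then have *: "\<sigma>1 \<le> \<sigma>" "\<bar>z\<bar> \<le> M" using assms(1) by (auto simp: space_mixing)
  show "\<bar>case s of (z, \<sigma>) \<Rightarrow> hermite_ratio k z \<sigma> x * normal_density z \<sigma> x\<bar>
     \<le> c * (1 + \<bar>x\<bar>) ^ k * (case s of (z, \<sigma>) \<Rightarrow> normal_density z \<sigma> x)"
    unfolding s using assms(3)[OF *] by (simp add: abs_mult mult_right_mono)
  have "normal_density z \<sigma> x \<le> 1 / \<sigma>1 * 1"
    using sigma1_pos by (intro order.trans[OF normal_density_le[OF sigma1_pos *(1)]] mult_left_mono) auto
  then show "(case s of (z, \<sigma>) \<Rightarrow> normal_density z \<sigma> x) \<le> 1 / \<sigma>1"
    by (simp add: s)
qed

lemma integrable_integrand: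
  "integrable F (\<lambda>(z, \<sigma>). hermite_ratio k z \<sigma> x * normal_density z \<sigma> x)"
proof -
  obtain c where c: "c \<ge> 0"
    "\<And>\<sigma> z x. \<sigma>1 \<le> \<sigma> \<Longrightarrow> \<bar>z\<bar> \<le> M \<Longrightarrow> \<bar>hermite_ratio k z \<sigma> x\<bar> \<le> c * (1 + \<bar>x\<bar>) ^ k"
    using hermite_ratio_bound[OF sigma1_pos, of M k] by metis
  show ?thesis
  proof (rule integrable_const_bound[of _ "c * (1 + \<bar>x\<bar>) ^ k * (1 / \<sigma>1)"])
    show "AE s in F. norm (case s of (z, \<sigma>) \<Rightarrow> hermite_ratio k z \<sigma> x * normal_density z \<sigma> x)
        \<le> c * (1 + \<bar>x\<bar>) ^ k * (1 / \<sigma>1)"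
    proof (rule AE_I2)
      fix s assume "s \<in> space F"
      note b = integrand_bound[OF this c]
      show "norm (case s of (z, \<sigma>) \<Rightarrow> hermite_ratio k z \<sigma> x * normal_density z \<sigma> x)
        \<le> c * (1 + \<bar>x\<bar>) ^ k * (1 / \<sigma>1)"
        using order.trans[OF b(1) mult_left_mono[OF b(2)]] c(1) by simp
    qed
  qed (rule measurable_integrand)
qed

lemma has_real_derivative_mixture_deriv:
  "(mixture_deriv k F has_real_derivative mixture_deriv (Suc k) F x) (at x)"
proof -
  obtain c where c: "c \<ge> 0"
    "\<And>\<sigma> z x. \<sigma>1 \<le> \<sigma> \<Longrightarrow> \<bar>z\<bar> \<le> M \<Longrightarrow> \<bar>hermite_ratio (Suc k) z \<sigma> x\<bar> \<le> c * (1 + \<bar>x\<bar>) ^ Suc k"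
    using hermite_ratio_bound[OF sigma1_pos, of M "Suc k"] by metis
  let ?f = "\<lambda>k s x. case s of (z, \<sigma>) \<Rightarrow> hermite_ratio k z \<sigma> x * normal_density z \<sigma> x"
  have "((\<lambda>y. \<integral>s. ?f k s y \<partial>F) has_real_derivative (\<integral>s. ?f (Suc k) s x \<partial>F)) (at x)"
  proof (rule has_real_derivative_lebesgue_integral)
    show "finite_measure F" by unfold_locales
    show "(?f k s has_real_derivative ?f (Suc k) s x) (at x)" if "s \<in> space F" for s x
    proof -
      obtain z \<sigma> where s: "s = (z, \<sigma>)" by fastforce
      then have "0 < \<sigma>" using that sigma1_pos by (auto simp: space_mixing)
      from has_real_derivative_hermite_ratio_normal[OF this] show ?thesis by (simp add: s)
    qed
    show "integrable F (\<lambda>s. ?f k s x)" for x by (rule integrable_integrand)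
    show "(\<lambda>s. ?f (Suc k) s x) \<in> borel_measurable F" by (rule measurable_integrand)
    show "\<bar>?f (Suc k) s y\<bar> \<le> c * (2 + \<bar>x\<bar>) ^ Suc k * (1 / \<sigma>1)" if "s \<in> space F" "\<bar>y - x\<bar> \<le> 1" for s y
    proof -
      note b = integrand_bound[OF that(1) c]
      have "\<bar>?f (Suc k) s y\<bar> \<le> c * (1 + \<bar>y\<bar>) ^ Suc k * (1 / \<sigma>1)"
        using order.trans[OF b(1) mult_left_mono[OF b(2)]] c(1) by simp
      also have "\<dots> \<le> c * (2 + \<bar>x\<bar>) ^ Suc k * (1 / \<sigma>1)"
        using that(2) c(1) sigma1_pos
        by (intro mult_right_mono mult_left_mono power_mono) auto
      finally show ?thesis .
    qed
  qed
  then show ?thesis unfolding mixture_deriv_def[abs_def] .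
qed

lemma mixture_density_pos: "0 < mixture_density F x"
proof -
  have int: "integrable F (\<lambda>(z, \<sigma>). normal_density z \<sigma> x)"
    using integrable_integrand[of 0 x] by simp
  have pos: "0 < (case s of (z, \<sigma>) \<Rightarrow> normal_density z \<sigma> x)" if "s \<in> space F" for s
    using that sigma1_pos by (auto simp: space_mixing intro: normal_density_pos)
  have "mixture_density F x \<noteq> 0"
  proof
    assume "mixture_density F x = 0"
    then have "AE s in F. (case s of (z, \<sigma>) \<Rightarrow> normal_density z \<sigma> x) = 0"
      unfolding mixture_density_def
      by (subst (asm) integral_nonneg_eq_0_iff_AE[OF int]) (auto intro!: AE_I2)
    with AE_space have "AE s in F. False"
      by eventually_elim (use pos in force)
    then show False by simp
  qed
  moreover have "0 \<le> mixture_density F x"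
    unfolding mixture_density_def by (rule integral_nonneg_AE) (auto intro!: AE_I2)
  ultimately show ?thesis by simp
qed

text \<open>
  Bounding the integrand by a multiple of the normal density, instead of by a constant, keeps the
  mixture density as a factor. The ratios of the derivatives to the density then grow polynomially,
  although the density itself tends to zero at infinity.
\<close>

lemma mixture_deriv_bound:
  assumes "c \<ge> 0"
    and "\<And>\<sigma> z x. \<sigma>1 \<le> \<sigma> \<Longrightarrow> \<bar>z\<bar> \<le> M \<Longrightarrow> \<bar>hermite_ratio k z \<sigma> x\<bar> \<le> c * (1 + \<bar>x\<bar>) ^ k"
  shows "\<bar>mixture_deriv k F x\<bar> \<le> c * (1 + \<bar>x\<bar>) ^ k * mixture_density F x"
proof -
  have int: "integrable F (\<lambda>(z, \<sigma>). normal_density z \<sigma> x)"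
    using integrable_integrand[of 0 x] by simp
  have "\<bar>mixture_deriv k F x\<bar>
     \<le> (\<integral>s. \<bar>case s of (z, \<sigma>) \<Rightarrow> hermite_ratio k z \<sigma> x * normal_density z \<sigma> x\<bar> \<partial>F)"
    unfolding mixture_deriv_def by (rule integral_abs_bound)
  also have "\<dots> \<le> (\<integral>s. c * (1 + \<bar>x\<bar>) ^ k * (case s of (z, \<sigma>) \<Rightarrow> normal_density z \<sigma> x) \<partial>F)"
    using integrand_bound(1)[OF _ assms] int integrable_integrand
    by (intro integral_mono integrable_abs integrable_mult_right) auto
  also have "\<dots> = c * (1 + \<bar>x\<bar>) ^ k * mixture_density F x"
    unfolding mixture_density_def by simp
  finally show ?thesis .
qed

lemma mixture_density_even: "mixture_density F (- x) = mixture_density F x"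
proof -
  let ?g = "\<lambda>s :: real \<times> real. case s of (z, \<sigma>) \<Rightarrow> (- z, \<sigma>)"
  have g: "?g \<in> measurable F F"
  proof -
    have "?g \<in> measurable borel borel" unfolding split_beta'
      by (simp add: borel_prod[symmetric])
    then have "?g \<in> measurable F borel" by (subst measurable_cong_sets[OF sets_mixing refl]) (rule measurable_restrict_space1)
    then have "?g \<in> measurable F (restrict_space borel ({-M..M} \<times> {\<sigma>1..\<sigma>2}))"
      by (rule measurable_restrict_space2[rotated]) (auto simp: space_mixing)
    then show ?thesis by (subst measurable_cong_sets[OF refl sets_mixing])
  qed
  have "mixture_density F (- x) = (\<integral>s. (case s of (z, \<sigma>) \<Rightarrow> normal_density z \<sigma> (- x)) \<partial>distr F F ?g)"
    using mixing by (simp add: mixture_density_def sym_mixing_def)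
  also have "\<dots> = (\<integral>s. (case ?g s of (z, \<sigma>) \<Rightarrow> normal_density z \<sigma> (- x)) \<partial>F)"
    by (rule integral_distr[OF g]) (use measurable_integrand[of 0 "- x"] in simp)
  also have "\<dots> = mixture_density F x"
    unfolding mixture_density_def
    by (intro Bochner_Integration.integral_cong) (auto simp: normal_density_def power2_commute)
  finally show ?thesis .
qed

end

section \<open>Log-densities of symmetric mixtures\<close>

definition log_deriv :: "(real \<Rightarrow> real) \<Rightarrow> nat \<Rightarrow> real \<Rightarrow> real" where
  "log_deriv \<eta> k = (deriv ^^ k) (ell \<eta>)"

lemma log_deriv_Suc:
  "(\<And>x. (log_deriv \<eta> k has_real_derivative g x) (at x)) \<Longrightarrow> log_deriv \<eta> (Suc k) = g"
  by (simp add: log_deriv_def fun_eq_iff DERIV_imp_deriv)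

text \<open>
  The properties of an error density on which the expansion rests. The growth exponents of the
  logarithmic derivatives are those of normal mixtures. The exponent 8 of the tail is ample: weights up
  to \<open>(1 + x\<^sup>2) ^ 7\<close> remain integrable, and the probability of the tail beyond \<open>t\<close> is at most of order
  \<open>(1 + t\<^sup>2) ^ (- 6)\<close>, so that its square root still absorbs the weight \<open>(1 + t\<^sup>2)\<^sup>2\<close> that bounds the
  derivatives, with an integrable factor to spare.
\<close>

definition tame_density :: "real \<Rightarrow> (real \<Rightarrow> real) \<Rightarrow> bool" where
  "tame_density A \<eta> \<longleftrightarrow>
     (\<forall>x. 0 < \<eta> x) \<and> (\<forall>x. \<eta> (- x) = \<eta> x) \<and>
     (\<integral>\<^sup>+x. ennreal (\<eta> x) \<partial>lborel) = 1 \<and> (\<forall>x. \<eta> x \<le> A / (1 + x\<^sup>2) ^ 8) \<and>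
     (\<forall>k<3. \<forall>x. (log_deriv \<eta> k has_real_derivative log_deriv \<eta> (Suc k) x) (at x)) \<and>
     continuous_on UNIV (log_deriv \<eta> 3) \<and>
     (\<forall>k\<in>{1..3}. \<forall>x. \<bar>log_deriv \<eta> k x\<bar> \<le> A * (1 + \<bar>x\<bar>) ^ k)"

context gaussian_mixture
begin

abbreviation deriv_ratio :: "nat \<Rightarrow> real \<Rightarrow> real" where
  "deriv_ratio k x \<equiv> mixture_deriv k F x / mixture_density F x"

lemma has_real_derivative_deriv_ratio:
  "(deriv_ratio k has_real_derivative deriv_ratio (Suc k) x - deriv_ratio k x * deriv_ratio 1 x) (at x)"
proof -
  have "(mixture_density F has_real_derivative mixture_deriv 1 F x) (at x)"
    using has_real_derivative_mixture_deriv[of 0 x] by (simp add: mixture_deriv_0)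
  from DERIV_divide[OF has_real_derivative_mixture_deriv this]
  show ?thesis using mixture_density_pos[of x]
    by (rule_tac DERIV_cong) (auto simp: field_simps)
qed

lemma has_real_derivative_ell:
  "(ell (mixture_density F) has_real_derivative deriv_ratio 1 x) (at x)"
proof -
  have "(mixture_density F has_real_derivative mixture_deriv 1 F x) (at x)"
    using has_real_derivative_mixture_deriv[of 0 x] by (simp add: mixture_deriv_0)
  from DERIV_chain'[OF this DERIV_ln_divide[OF mixture_density_pos]] show ?thesis
    unfolding ell_def[abs_def] by simp
qed

lemma log_deriv_0: "log_deriv (mixture_density F) 0 = ell (mixture_density F)"
  by (simp add: log_deriv_def)

lemma log_deriv_1: "log_deriv (mixture_density F) 1 = deriv_ratio 1"
  unfolding One_nat_def by (rule log_deriv_Suc) (simp add: log_deriv_0 has_real_derivative_ell[simplified])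

lemma log_deriv_2:
  "log_deriv (mixture_density F) 2 = (\<lambda>x. deriv_ratio 2 x - deriv_ratio 1 x * deriv_ratio 1 x)"
proof -
  have "log_deriv (mixture_density F) (Suc 1)
      = (\<lambda>x. deriv_ratio (Suc 1) x - deriv_ratio 1 x * deriv_ratio 1 x)"
    by (rule log_deriv_Suc) (simp only: log_deriv_1 has_real_derivative_deriv_ratio)
  then show ?thesis by (simp only: Suc_1)
qed

lemma has_real_derivative_log_deriv_2:
  "(log_deriv (mixture_density F) 2 has_real_derivative
     deriv_ratio 3 x - 3 * deriv_ratio 1 x * deriv_ratio 2 x + 2 * deriv_ratio 1 x ^ 3) (at x)"
proof -
  note d = has_real_derivative_deriv_ratio
  show ?thesis unfolding log_deriv_2
    by (rule DERIV_cong[OF DERIV_diff[OF d DERIV_mult[OF d d]]])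
       (simp add: numeral_2_eq_2[symmetric] numeral_3_eq_3[symmetric] algebra_simps power3_eq_cube)
qed

lemma log_deriv_3:
  "log_deriv (mixture_density F) 3 =
     (\<lambda>x. deriv_ratio 3 x - 3 * deriv_ratio 1 x * deriv_ratio 2 x + 2 * deriv_ratio 1 x ^ 3)"
  using log_deriv_Suc[OF has_real_derivative_log_deriv_2] by (simp add: eval_nat_numeral)

lemma has_real_derivative_log_deriv:
  assumes "k < 3"
  shows "(log_deriv (mixture_density F) k has_real_derivative log_deriv (mixture_density F) (Suc k) x) (at x)"
proof -
  consider "k = 0" | "k = 1" | "k = 2" using assms by linarith
  then show ?thesis
  proof cases
    case 1
    then show ?thesis using has_real_derivative_ell log_deriv_0 log_deriv_1 by simp
  next
    case 2
    then show ?thesis using has_real_derivative_deriv_ratio[of 1] log_deriv_1 log_deriv_2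
      by (simp add: numeral_2_eq_2)
  next
    case 3
    then show ?thesis using has_real_derivative_log_deriv_2 log_deriv_3 by (simp add: eval_nat_numeral)
  qed
qed

lemma continuous_log_deriv_3: "continuous_on UNIV (log_deriv (mixture_density F) 3)"
proof -
  have "continuous_on UNIV (deriv_ratio k)" for k
    using has_real_derivative_deriv_ratio DERIV_isCont continuous_at_imp_continuous_on by blast
  then show ?thesis unfolding log_deriv_3
    by (intro continuous_on_add continuous_on_diff continuous_on_power
      continuous_on_mult[OF continuous_on_mult] continuous_on_mult continuous_on_const)
qed

text \<open>
  The third logarithmic derivative is a polynomial in the ratios \<open>deriv_ratio k\<close> that is homogeneous of
  weight 3, and the first two likewise with weights 1 and 2; each ratio of index \<open>k\<close> contributes \<open>(1 + \<bar>x\<bar>) ^ k\<close>.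
\<close>

lemma log_deriv_bound:
  assumes c: "\<And>k. 0 \<le> c k"
    "\<And>k \<sigma> z x. \<sigma>1 \<le> \<sigma> \<Longrightarrow> \<bar>z\<bar> \<le> M \<Longrightarrow> \<bar>hermite_ratio k z \<sigma> x\<bar> \<le> c k * (1 + \<bar>x\<bar>) ^ k"
    and k: "k \<in> {1..3}"
  shows "\<bar>log_deriv (mixture_density F) k x\<bar>
    \<le> (c 1 + c 2 + c 1 * c 1 + c 3 + 3 * c 1 * c 2 + 2 * c 1 ^ 3) * (1 + \<bar>x\<bar>) ^ k"
    (is "_ \<le> ?A * _")
proof -
  let ?y = "1 + \<bar>x\<bar>"
  have b: "\<bar>deriv_ratio k x\<bar> \<le> c k * ?y ^ k" for k
    using mixture_deriv_bound[OF c, of k x] mixture_density_pos[of x]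
    by (simp add: divide_le_eq)
  have b1: "\<bar>deriv_ratio 1 x\<bar> \<le> c 1 * ?y" using b[of 1] by simp
  have A: "c 1 \<le> ?A" "c 2 + c 1 * c 1 \<le> ?A" "c 3 + 3 * c 1 * c 2 + 2 * c 1 ^ 3 \<le> ?A"
    using c(1) by (simp_all add: add_nonneg_nonneg mult_nonneg_nonneg)
  have 11: "\<bar>deriv_ratio 1 x * deriv_ratio 1 x\<bar> \<le> c 1 * ?y * (c 1 * ?y)"
    unfolding abs_mult using b1 c(1) by (intro mult_mono) auto
  have 12: "\<bar>deriv_ratio 1 x * deriv_ratio 2 x\<bar> \<le> c 1 * ?y * (c 2 * ?y ^ 2)"
    unfolding abs_mult using b1 b[of 2] c(1) by (intro mult_mono) auto
  have 13: "\<bar>deriv_ratio 1 x ^ 3\<bar> \<le> (c 1 * ?y) ^ 3"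
    unfolding power_abs using b1 by (intro power_mono) auto
  consider "k = 1" | "k = 2" | "k = 3" using k by fastforce
  then show ?thesis
  proof cases
    case 1
    have "c 1 * ?y \<le> ?A * ?y" using A(1) by (intro mult_right_mono) auto
    then show ?thesis using b1 by (simp add: 1 log_deriv_1[simplified])
  next
    case 2
    have "\<bar>log_deriv (mixture_density F) 2 x\<bar> \<le> c 2 * ?y ^ 2 + c 1 * ?y * (c 1 * ?y)"
      unfolding log_deriv_2 using b[of 2] 11 by linarith
    also have "\<dots> = (c 2 + c 1 * c 1) * ?y ^ 2" by (simp add: algebra_simps power2_eq_square)
    also have "\<dots> \<le> ?A * ?y ^ 2" using A(2) by (intro mult_right_mono) auto
    finally show ?thesis by (simp only: 2)
  next
    case 3
    have "\<bar>log_deriv (mixture_density F) 3 x\<bar> \<le>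
        c 3 * ?y ^ 3 + 3 * (c 1 * ?y * (c 2 * ?y ^ 2)) + 2 * (c 1 * ?y) ^ 3"
      unfolding log_deriv_3 using b[of 3] 12 13 by linarith
    also have "\<dots> = (c 3 + 3 * c 1 * c 2 + 2 * c 1 ^ 3) * ?y ^ 3"
      by (simp add: algebra_simps power2_eq_square power3_eq_cube)
    also have "\<dots> \<le> ?A * ?y ^ 3" using A(3) by (intro mult_right_mono) auto
    finally show ?thesis by (simp only: 3)
  qed
qed

lemma nn_integral_mixture_density: "(\<integral>\<^sup>+x. ennreal (mixture_density F x) \<partial>lborel) = 1"
proof -
  have F: "sigma_finite_measure F" by unfold_locales
  interpret pair_sigma_finite F lborel
    by (intro pair_sigma_finite.intro F sigma_finite_lborel)
  have int: "integrable F (\<lambda>(z, \<sigma>). normal_density z \<sigma> x)" for x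
    using integrable_integrand[of 0 x] by simp
  let ?f = "\<lambda>(s :: real \<times> real) x. ennreal (case s of (z, \<sigma>) \<Rightarrow> normal_density z \<sigma> x)"
  have meas: "case_prod ?f \<in> borel_measurable (F \<Otimes>\<^sub>M lborel)"
  proof -
    have "case_prod ?f \<in> borel_measurable ((borel \<Otimes>\<^sub>M borel) \<Otimes>\<^sub>M borel)"
      unfolding normal_density_def split_beta' by measurable
    then have *: "case_prod ?f \<in> borel_measurable (borel \<Otimes>\<^sub>M borel)"
      by (simp only: borel_prod)
    have "(\<lambda>s. s) \<in> measurable F borel"
      by (subst measurable_cong_sets[OF sets_mixing refl]) (rule measurable_restrict_space1, simp)
    then have "(\<lambda>p. (fst p, snd p)) \<in> measurable (F \<Otimes>\<^sub>M lborel) (borel \<Otimes>\<^sub>M borel)"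
      by measurable
    from measurable_compose[OF this *] show ?thesis by simp
  qed
  have "(\<integral>\<^sup>+x. ennreal (mixture_density F x) \<partial>lborel) = (\<integral>\<^sup>+x. (\<integral>\<^sup>+s. ?f s x \<partial>F) \<partial>lborel)"
    unfolding mixture_density_def
    by (intro nn_integral_cong nn_integral_eq_integral[symmetric] int) (auto intro!: AE_I2)
  also have "\<dots> = (\<integral>\<^sup>+s. (\<integral>\<^sup>+x. ?f s x \<partial>lborel) \<partial>F)"
    by (rule Fubini'[OF meas])
  also have "\<dots> = (\<integral>\<^sup>+s. 1 \<partial>F)"
  proof (rule nn_integral_cong)
    fix s assume "s \<in> space F"
    then obtain z \<sigma> where s: "s = (z, \<sigma>)" "\<sigma> > 0" using sigma1_pos by (auto simp: space_mixing)
    then show "(\<integral>\<^sup>+x. ?f s x \<partial>lborel) = 1"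
      by (simp add: nn_integral_eq_integral)
  qed
  finally show ?thesis by (simp add: emeasure_space_1)
qed

text \<open>
  From \<open>(x - z)\<^sup>2 \<ge> x\<^sup>2 / 2 - z\<^sup>2\<close> every component lies below a centred Gaussian envelope with the same
  rate \<open>c\<close>, and \<open>exp u \<ge> (u / 8) ^ 8\<close> turns the envelope into a power of \<open>1 + x\<^sup>2\<close>.
\<close>

lemma mixture_density_tail:
  defines "c \<equiv> 1 / (4 * \<sigma>2\<^sup>2)"
  shows "mixture_density F x \<le> (1 / \<sigma>1 * exp (M\<^sup>2 / (2 * \<sigma>1\<^sup>2)) * exp c * (8 / c) ^ 8) / (1 + x\<^sup>2) ^ 8"
proof -
  let ?B = "1 / \<sigma>1 * exp (M\<^sup>2 / (2 * \<sigma>1\<^sup>2)) * exp (- c * x\<^sup>2)"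
  have int: "integrable F (\<lambda>(z, \<sigma>). normal_density z \<sigma> x)"
    using integrable_integrand[of 0 x] by simp
  have "space F \<noteq> {}" by (rule not_empty)
  then have s2: "0 < \<sigma>2" using sigma1_pos by (auto simp: space_mixing)
  then have c0: "0 < c" by (simp add: c_def)
  have "mixture_density F x \<le> (\<integral>s. ?B \<partial>F)"
    unfolding mixture_density_def
  proof (rule integral_mono[OF int])
    fix s assume "s \<in> space F"
    then obtain z \<sigma> where s: "s = (z, \<sigma>)" and *: "\<sigma>1 \<le> \<sigma>" "\<sigma> \<le> \<sigma>2" "\<bar>z\<bar> \<le> M"
      by (auto simp: space_mixing abs_le_iff)
    have "0 < \<sigma>" using * sigma1_pos by linarith
    \<comment> \<open>half of this square is the difference of the two sides below\<close>
    have "0 \<le> (x - 2 * z)\<^sup>2" by simp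
    then have "x\<^sup>2 / 2 - z\<^sup>2 \<le> (x - z)\<^sup>2" by (simp add: power2_eq_square algebra_simps)
    then have "(x\<^sup>2 / 2 - z\<^sup>2) / (2 * \<sigma>\<^sup>2) \<le> (x - z)\<^sup>2 / (2 * \<sigma>\<^sup>2)"
      by (intro divide_right_mono) auto
    moreover have "z\<^sup>2 / (2 * \<sigma>\<^sup>2) \<le> M\<^sup>2 / (2 * \<sigma>1\<^sup>2)"
      using * sigma1_pos by (intro frac_le mult_left_mono abs_le_square_iff[THEN iffD1]) auto
    moreover have "c * x\<^sup>2 \<le> (x\<^sup>2 / 2) / (2 * \<sigma>\<^sup>2)"
      unfolding c_def using * \<open>0 < \<sigma>\<close>
      by (auto simp: intro!: frac_le)
    ultimately have "- (x - z)\<^sup>2 / (2 * \<sigma>\<^sup>2) \<le> M\<^sup>2 / (2 * \<sigma>1\<^sup>2) + - c * x\<^sup>2"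
      by (simp add: diff_divide_distrib)
    then have "exp (- (x - z)\<^sup>2 / (2 * \<sigma>\<^sup>2)) \<le> exp (M\<^sup>2 / (2 * \<sigma>1\<^sup>2)) * exp (- c * x\<^sup>2)"
      by (simp add: exp_add[symmetric])
    then have "normal_density z \<sigma> x \<le> 1 / \<sigma>1 * (exp (M\<^sup>2 / (2 * \<sigma>1\<^sup>2)) * exp (- c * x\<^sup>2))"
      using sigma1_pos by (intro order.trans[OF normal_density_le[OF sigma1_pos *(1)]] mult_left_mono) auto
    then show "(case s of (z, \<sigma>) \<Rightarrow> normal_density z \<sigma> x) \<le> ?B"
      by (simp add: s mult.assoc)
  qed simp
  also have "\<dots> = ?B" by (simp add: prob_space)
  also have "\<dots> \<le> (1 / \<sigma>1 * exp (M\<^sup>2 / (2 * \<sigma>1\<^sup>2))) * (exp c * (8 / c) ^ 8 / (1 + x\<^sup>2) ^ 8)"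
  proof (rule mult_left_mono)
    let ?u = "c * (1 + x\<^sup>2) / 8"
    have "?u ^ 8 \<le> exp ?u ^ 8"
    proof (rule power_mono)
      show "?u \<le> exp ?u" using exp_ge_add_one_self[of ?u] by linarith
      show "0 \<le> ?u" using c0 by simp
    qed
    also have "exp ?u ^ 8 = exp (c * (1 + x\<^sup>2))"
      by (simp add: exp_of_nat_mult[symmetric])
    finally have le: "?u ^ 8 \<le> exp (c * (1 + x\<^sup>2))" .
    have "0 < 1 + x\<^sup>2" by (rule add_pos_nonneg) auto
    then have "0 < ?u ^ 8" using c0 by (intro zero_less_power divide_pos_pos mult_pos_pos) auto
    then have "exp (- (c * (1 + x\<^sup>2))) \<le> inverse (?u ^ 8)"
      unfolding exp_minus by (intro le_imp_inverse_le le)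
    also have "\<dots> = (8 / c) ^ 8 / (1 + x\<^sup>2) ^ 8"
      by (simp only: power_mult_distrib power_divide) simp
    finally have "exp c * exp (- (c * (1 + x\<^sup>2))) \<le> exp c * ((8 / c) ^ 8 / (1 + x\<^sup>2) ^ 8)"
      by (intro mult_left_mono) auto
    moreover have "exp c * exp (- (c * (1 + x\<^sup>2))) = exp (- c * x\<^sup>2)"
      by (simp add: exp_add[symmetric] algebra_simps)
    ultimately show "exp (- c * x\<^sup>2) \<le> exp c * (8 / c) ^ 8 / (1 + x\<^sup>2) ^ 8" by simp
  qed (use sigma1_pos in auto)
  finally show ?thesis by simp
qed

end

lemma mixture_class_tame:
  assumes "0 < \<sigma>1"
  obtains A where "1 \<le> A" "\<And>\<eta>. \<eta> \<in> mixture_class M \<sigma>1 \<sigma>2 \<Longrightarrow> tame_density A \<eta>"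
proof -
  have "\<forall>k. \<exists>c\<ge>0. \<forall>\<sigma>\<ge>\<sigma>1. \<forall>z. \<bar>z\<bar> \<le> M \<longrightarrow> (\<forall>x. \<bar>hermite_ratio k z \<sigma> x\<bar> \<le> c * (1 + \<bar>x\<bar>) ^ k)"
    using hermite_ratio_bound[OF assms] by blast
  then obtain c where c: "\<And>k. 0 \<le> c k"
    "\<And>k \<sigma> z x. \<sigma>1 \<le> \<sigma> \<Longrightarrow> \<bar>z\<bar> \<le> M \<Longrightarrow> \<bar>hermite_ratio k z \<sigma> x\<bar> \<le> c k * (1 + \<bar>x\<bar>) ^ k"
    by metis
  define A1 where "A1 = c 1 + c 2 + c 1 * c 1 + c 3 + 3 * c 1 * c 2 + 2 * c 1 ^ 3"
  define d where "d = 1 / (4 * \<sigma>2\<^sup>2)"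
  define A2 where "A2 = 1 / \<sigma>1 * exp (M\<^sup>2 / (2 * \<sigma>1\<^sup>2)) * exp d * (8 / d) ^ 8"
  define A where "A = max 1 (max A1 A2)"
  have "tame_density A \<eta>" if \<eta>: "\<eta> \<in> mixture_class M \<sigma>1 \<sigma>2" for \<eta>
  proof -
    obtain F where F: "F \<in> sym_mixing M \<sigma>1 \<sigma>2" and \<eta>_eq: "\<eta> = mixture_density F"
      using \<eta> by (auto simp: mixture_class_def)
    interpret gaussian_mixture M \<sigma>1 \<sigma>2 F
      by unfold_locales (use assms F in auto)
    have "mixture_density F x \<le> A / (1 + x\<^sup>2) ^ 8" for x
    proof -
      have "A2 / (1 + x\<^sup>2) ^ 8 \<le> A / (1 + x\<^sup>2) ^ 8"
        by (intro divide_right_mono) (auto simp: A_def)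
      then show ?thesis using mixture_density_tail[of x] unfolding A2_def d_def by linarith
    qed
    moreover have "\<bar>log_deriv \<eta> k x\<bar> \<le> A * (1 + \<bar>x\<bar>) ^ k" if "k \<in> {1..3}" for k x
    proof -
      have "A1 * (1 + \<bar>x\<bar>) ^ k \<le> A * (1 + \<bar>x\<bar>) ^ k"
        by (intro mult_right_mono) (auto simp: A_def)
      then show ?thesis using log_deriv_bound[OF c that, of x] unfolding A1_def
        unfolding \<eta>_eq by (rule order.trans[rotated])
    qed
    ultimately show ?thesis
      unfolding tame_density_def
      using mixture_density_pos mixture_density_even nn_integral_mixture_density
        has_real_derivative_log_deriv continuous_log_deriv_3 \<eta>_eq by simp
  qed
  then show thesis by (intro that[of A]) (auto simp: A_def)
qed

section \<open>Integrals against the error density\<close>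

lemma integrable_inverse_one_plus_square: "integrable lborel (\<lambda>x::real. 1 / (1 + x\<^sup>2))"
  using integrable_inverse_1_plus_square by (simp add: set_integrable_def einterval_def inverse_eq_divide)

lemma integral_inverse_one_plus_square: "(\<integral>x. 1 / (1 + x\<^sup>2) \<partial>lborel) = (pi :: real)"
  using LBINT_inverse_1_plus_square
  by (simp add: interval_lebesgue_integral_def set_lebesgue_integral_def einterval_def inverse_eq_divide)

lemma one_plus_abs_le: "1 + \<bar>x\<bar> \<le> 2 * (1 + (x::real)\<^sup>2)" "(1 + \<bar>x\<bar>)\<^sup>2 \<le> 2 * (1 + x\<^sup>2)"
  "(1 + \<bar>x\<bar>) ^ 3 \<le> 4 * (1 + x\<^sup>2)\<^sup>2"
proof -
  have sq: "0 \<le> (1 - \<bar>x\<bar>)\<^sup>2" by simp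
  then show 2: "(1 + \<bar>x\<bar>)\<^sup>2 \<le> 2 * (1 + x\<^sup>2)" by (simp add: power2_eq_square algebra_simps)
  have "(1 + \<bar>x\<bar>) ^ 1 \<le> (1 + \<bar>x\<bar>)\<^sup>2" by (rule power_increasing) auto
  then show "1 + \<bar>x\<bar> \<le> 2 * (1 + x\<^sup>2)" using 2 by simp
  have "(1 + \<bar>x\<bar>) ^ 3 \<le> (1 + \<bar>x\<bar>) ^ 4" by (rule power_increasing) auto
  also have "\<dots> = ((1 + \<bar>x\<bar>)\<^sup>2)\<^sup>2" by simp
  also have "\<dots> \<le> (2 * (1 + x\<^sup>2))\<^sup>2" using 2 by (intro power_mono) auto
  finally show "(1 + \<bar>x\<bar>) ^ 3 \<le> 4 * (1 + x\<^sup>2)\<^sup>2" unfolding power_mult_distrib by simp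
qed

lemma tame_densityD:
  assumes "tame_density A \<eta>"
  shows "0 < \<eta> x" "\<eta> (- x) = \<eta> x" "(\<integral>\<^sup>+x. ennreal (\<eta> x) \<partial>lborel) = 1"
    "\<eta> x \<le> A / (1 + x\<^sup>2) ^ 8"
    "k < 3 \<Longrightarrow> (log_deriv \<eta> k has_real_derivative log_deriv \<eta> (Suc k) x) (at x)"
    "continuous_on UNIV (log_deriv \<eta> 3)"
    "k \<in> {1..3} \<Longrightarrow> \<bar>log_deriv \<eta> k x\<bar> \<le> A * (1 + \<bar>x\<bar>) ^ k"
  using assms unfolding tame_density_def by blast+

lemma tame_density_nonneg_const:
  assumes "tame_density A \<eta>" shows "0 \<le> A"
  using tame_densityD(1,4)[OF assms, of 0] by simp

lemma continuous_log_deriv: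
  assumes "tame_density A \<eta>" "k \<le> 3"
  shows "continuous_on UNIV (log_deriv \<eta> k)"
proof (cases "k = 3")
  case False
  then show ?thesis
    using tame_densityD(5)[OF assms(1), of k] assms(2)
    by (intro continuous_at_imp_continuous_on ballI) (auto intro: DERIV_isCont)
qed (use tame_densityD(6)[OF assms(1)] in simp)

lemma ell_dot_eq: "ell_dot \<eta> x = - log_deriv \<eta> 1 x"
  by (simp add: ell_dot_def log_deriv_def)

lemma tame_has_real_derivative:
  assumes "tame_density A \<eta>"
  shows "(\<eta> has_real_derivative log_deriv \<eta> 1 x * \<eta> x) (at x)"
proof -
  have "(ell \<eta> has_real_derivative log_deriv \<eta> 1 x) (at x)"
    using tame_densityD(5)[OF assms, of 0 x] by (simp add: log_deriv_def)
  from DERIV_fun_exp[OF this]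
  have "((\<lambda>x. exp (ell \<eta> x)) has_real_derivative exp (ell \<eta> x) * log_deriv \<eta> 1 x) (at x)" .
  moreover have "exp (ell \<eta> x) = \<eta> x" for x
    using tame_densityD(1)[OF assms, of x] by (simp add: ell_def)
  ultimately show ?thesis by (simp add: mult.commute)
qed

text \<open>
  The symmetry of the mixing measure enters the expansion only through this: the score of an even
  density is odd, hence has mean zero under any other even density.
\<close>

lemma log_deriv_odd:
  assumes "tame_density A \<eta>"
  shows "log_deriv \<eta> 1 (- x) = - log_deriv \<eta> 1 x"
proof -
  have *: "(ell \<eta> has_real_derivative log_deriv \<eta> 1 x) (at x)" for x
    using tame_densityD(5)[OF assms, of 0 x] by (simp add: log_deriv_def)
  have "ell \<eta> (- x) = ell \<eta> x" for x
    using tame_densityD(2)[OF assms] by (simp add: ell_def)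
  moreover have "((\<lambda>x. ell \<eta> (- x)) has_real_derivative log_deriv \<eta> 1 (- x) * (- 1)) (at x)"
    by (rule DERIV_chain2[OF *]) (auto intro!: derivative_eq_intros)
  ultimately have "(ell \<eta> has_real_derivative - log_deriv \<eta> 1 (- x)) (at x)" by simp
  from DERIV_unique[OF * this] show ?thesis by simp
qed

lemma integrable_lborel_of_decay:
  fixes f :: "real \<Rightarrow> real"
  assumes [measurable]: "f \<in> borel_measurable borel" and "\<And>x. \<bar>f x\<bar> \<le> B / (1 + x\<^sup>2)"
  shows "integrable lborel f"
proof (rule Bochner_Integration.integrable_bound)
  show "integrable lborel (\<lambda>x. B * (1 / (1 + x\<^sup>2)))"
    by (rule integrable_mult_right[OF integrable_inverse_one_plus_square])
  show "AE x in lborel. norm (f x) \<le> norm (B * (1 / (1 + x\<^sup>2)))"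
  proof (rule AE_I2)
    fix x
    have "norm (f x) \<le> B * (1 / (1 + x\<^sup>2))" using assms(2)[of x] by simp
    then show "norm (f x) \<le> norm (B * (1 / (1 + x\<^sup>2)))"
      unfolding real_norm_def by (rule order.trans[OF _ abs_ge_self])
  qed
qed simp

locale tame_error =
  fixes A :: real and \<eta>0 :: "real \<Rightarrow> real"
  assumes tame: "tame_density A \<eta>0"
begin

lemma continuous_density: "continuous_on UNIV \<eta>0"
  using tame_has_real_derivative[OF tame]
  by (intro continuous_at_imp_continuous_on ballI) (auto intro: DERIV_isCont)

lemma measurable_density [measurable]: "\<eta>0 \<in> borel_measurable borel"
  using continuous_density by (rule borel_measurable_continuous_onI)

lemma sets_error_law [measurable_cong, simp]: "sets (error_law \<eta>0) = sets borel"
  by (simp add: error_law_def)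

lemma space_error_law [simp]: "space (error_law \<eta>0) = UNIV"
  by (simp add: error_law_def)

sublocale error: prob_space "error_law \<eta>0"
  by (rule prob_spaceI) (simp add: error_law_def emeasure_density tame_densityD(3)[OF tame])

lemma integral_error_law:
  fixes f :: "real \<Rightarrow> real"
  assumes "f \<in> borel_measurable borel"
  shows "(\<integral>x. f x \<partial>error_law \<eta>0) = (\<integral>x. \<eta>0 x * f x \<partial>lborel)"
  unfolding error_law_def using assms tame_densityD(1)[OF tame]
  by (intro integral_real_density) (auto intro: less_imp_le)

lemma density_growth_bound:
  assumes "\<bar>y\<bar> \<le> B * (1 + x\<^sup>2) ^ 7"
  shows "\<bar>\<eta>0 x * y\<bar> \<le> (A * B) / (1 + x\<^sup>2)"
proof -
  have pos: "0 < 1 + x\<^sup>2" by (rule add_pos_nonneg) auto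
  have "\<bar>\<eta>0 x * y\<bar> \<le> A / (1 + x\<^sup>2) ^ 8 * (B * (1 + x\<^sup>2) ^ 7)"
    unfolding abs_mult using assms tame_densityD(1,4)[OF tame, of x]
    by (intro mult_mono) auto
  also have "\<dots> = (A * B) / (1 + x\<^sup>2)"
    using pos by (simp add: divide_simps eval_nat_numeral)
  finally show ?thesis .
qed

lemma integrable_error_law:
  fixes f :: "real \<Rightarrow> real"
  assumes [measurable]: "f \<in> borel_measurable borel" and "\<And>x. \<bar>f x\<bar> \<le> B * (1 + x\<^sup>2) ^ 7"
  shows "integrable (error_law \<eta>0) f"
proof -
  have "integrable lborel (\<lambda>x. \<eta>0 x * f x)"
    using density_growth_bound[OF assms(2)] by (intro integrable_lborel_of_decay) auto
  then show ?thesis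
    unfolding error_law_def using tame_densityD(1)[OF tame]
    by (subst integrable_real_density) (auto intro: less_imp_le)
qed

lemma integral_error_law_le:
  fixes f :: "real \<Rightarrow> real"
  assumes [measurable]: "f \<in> borel_measurable borel" and "\<And>x. \<bar>f x\<bar> \<le> B * (1 + x\<^sup>2) ^ 7"
  shows "\<bar>\<integral>x. f x \<partial>error_law \<eta>0\<bar> \<le> A * B * pi"
proof -
  have "\<bar>\<integral>x. f x \<partial>error_law \<eta>0\<bar> \<le> (\<integral>x. \<bar>\<eta>0 x * f x\<bar> \<partial>lborel)"
    by (simp add: integral_error_law integral_abs_bound)
  also have "\<dots> \<le> (\<integral>x. (A * B) * (1 / (1 + x\<^sup>2)) \<partial>lborel)"
    using density_growth_bound[OF assms(2)]
    by (intro integral_mono integrable_abs integrable_lborel_of_decay[of _ "A * B"]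
        integrable_mult_right integrable_inverse_one_plus_square) auto
  also have "\<dots> = A * B * pi"
    by (subst integral_mult_right_zero) (simp only: integral_inverse_one_plus_square)
  finally show ?thesis .
qed

lemma integral_odd_error_law:
  fixes f :: "real \<Rightarrow> real"
  assumes [measurable]: "f \<in> borel_measurable borel" and odd: "\<And>x. f (- x) = - f x"
  shows "(\<integral>x. f x \<partial>error_law \<eta>0) = 0"
proof -
  have "(\<integral>x. \<eta>0 x * f x \<partial>lborel) = (\<integral>x. \<eta>0 (- x) * f (- x) \<partial>lborel)"
    using lborel_integral_real_affine[of "-1" "\<lambda>x. \<eta>0 x * f x" 0] by simp
  also have "\<dots> = - (\<integral>x. \<eta>0 x * f x \<partial>lborel)"
    by (simp add: odd tame_densityD(2)[OF tame])
  finally show ?thesis by (simp add: integral_error_law)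
qed

lemma integral_score_zero:
  assumes "tame_density B \<eta>"
  shows "(\<integral>x. ell_dot \<eta> x \<partial>error_law \<eta>0) = 0"
proof -
  have "log_deriv \<eta> 1 \<in> borel_measurable borel"
    by (rule borel_measurable_continuous_onI[OF continuous_log_deriv[OF assms]]) simp
  then show ?thesis
    using log_deriv_odd[OF assms]
    by (intro integral_odd_error_law) (auto simp: ell_dot_eq[abs_def])
qed

text \<open>
  The information identity across two densities. The function \<open>\<eta>0 * log_deriv \<eta> 1\<close> vanishes at both
  infinities, so its derivative integrates to zero, and the derivative of \<open>\<eta>0\<close> is \<open>log_deriv \<eta>0 1 * \<eta>0\<close>.
\<close>

lemma integral_second_log_deriv:
  assumes \<eta>: "tame_density A \<eta>"
  shows "(\<integral>x. log_deriv \<eta> 2 x \<partial>error_law \<eta>0) = - info \<eta>0 \<eta>"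
proof -
  let ?l = "log_deriv \<eta>" and ?m = "log_deriv \<eta>0"
  note cont = continuous_log_deriv[OF \<eta>] continuous_log_deriv[OF tame] continuous_density
  have [measurable]: "?l 1 \<in> borel_measurable borel" "?l 2 \<in> borel_measurable borel"
    "?m 1 \<in> borel_measurable borel"
    using cont by (auto intro: borel_measurable_continuous_onI)
  have A0: "0 \<le> A" by (rule tame_density_nonneg_const[OF tame])
  have one: "1 \<le> 1 + x\<^sup>2" for x :: real by simp
  have l1: "\<bar>?l 1 x\<bar> \<le> A * (2 * (1 + x\<^sup>2))" "\<bar>?m 1 x\<bar> \<le> A * (2 * (1 + x\<^sup>2))" for x
    using order.trans[OF tame_densityD(7)[OF \<eta>, of 1 x] mult_left_mono[OF _ A0]]
      order.trans[OF tame_densityD(7)[OF tame, of 1 x] mult_left_mono[OF _ A0]]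
      one_plus_abs_le(1)[of x] by simp_all
  have l2: "\<bar>?l 2 x\<bar> \<le> A * (2 * (1 + x\<^sup>2))" for x
    using order.trans[OF tame_densityD(7)[OF \<eta>, of 2 x] mult_left_mono[OF _ A0]]
      one_plus_abs_le(2)[of x] by simp
  have d2: "\<bar>\<eta>0 x * ?l 2 x\<bar> \<le> (A * (2 * A)) / (1 + x\<^sup>2)" for x
  proof (rule density_growth_bound)
    have "\<bar>?l 2 x\<bar> \<le> 2 * A * (1 + x\<^sup>2) ^ 1" using l2[of x] by (simp add: algebra_simps)
    also have "\<dots> \<le> 2 * A * (1 + x\<^sup>2) ^ 7" using A0 by (intro mult_left_mono power_increasing) auto
    finally show "\<bar>?l 2 x\<bar> \<le> 2 * A * (1 + x\<^sup>2) ^ 7" .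
  qed
  have d1: "\<bar>\<eta>0 x * ?l 1 x\<bar> \<le> (A * (2 * A)) / (1 + x\<^sup>2)" for x
  proof (rule density_growth_bound)
    have "\<bar>?l 1 x\<bar> \<le> 2 * A * (1 + x\<^sup>2) ^ 1" using l1(1)[of x] by (simp add: algebra_simps)
    also have "\<dots> \<le> 2 * A * (1 + x\<^sup>2) ^ 7" using A0 by (intro mult_left_mono power_increasing) auto
    finally show "\<bar>?l 1 x\<bar> \<le> 2 * A * (1 + x\<^sup>2) ^ 7" .
  qed
  have d11: "\<bar>\<eta>0 x * (?l 1 x * ?m 1 x)\<bar> \<le> (A * (4 * A\<^sup>2)) / (1 + x\<^sup>2)" for x
  proof (rule density_growth_bound)
    have "\<bar>?l 1 x * ?m 1 x\<bar> \<le> (A * (2 * (1 + x\<^sup>2))) * (A * (2 * (1 + x\<^sup>2)))"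
      unfolding abs_mult using l1[of x] A0 by (intro mult_mono) auto
    also have "\<dots> = 4 * A\<^sup>2 * (1 + x\<^sup>2) ^ 2" by (simp only: power2_eq_square) (simp only: mult_ac)
    also have "\<dots> \<le> 4 * A\<^sup>2 * (1 + x\<^sup>2) ^ 7" by (intro mult_left_mono power_increasing) auto
    finally show "\<bar>?l 1 x * ?m 1 x\<bar> \<le> 4 * A\<^sup>2 * (1 + x\<^sup>2) ^ 7" .
  qed
  let ?f = "\<lambda>x. \<eta>0 x * ?l 2 x + \<eta>0 x * (?l 1 x * ?m 1 x)"
  have int: "integrable lborel (\<lambda>x. \<eta>0 x * ?l 2 x)"
    "integrable lborel (\<lambda>x. \<eta>0 x * (?l 1 x * ?m 1 x))"
    by (rule integrable_lborel_of_decay[OF _ d2] integrable_lborel_of_decay[OF _ d11]; measurable)+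
  have lim: "((\<lambda>x. \<eta>0 x * ?l 1 x) \<longlongrightarrow> 0) G"
    if "((\<lambda>x::real. (A * (2 * A)) / (1 + x\<^sup>2)) \<longlongrightarrow> 0) G" for G
    by (rule Lim_null_comparison[OF _ that]) (use d1 in auto)
  have "(LBINT x=-\<infinity>..\<infinity>. ?f x) = 0 - 0"
  proof (rule interval_integral_FTC_integrable[where F="\<lambda>x. \<eta>0 x * ?l 1 x"])
    show "((\<lambda>x. \<eta>0 x * ?l 1 x) has_vector_derivative ?f x) (at x)" for x
      unfolding has_real_derivative_iff_has_vector_derivative[symmetric]
      using DERIV_mult[OF tame_has_real_derivative[OF tame] tame_densityD(5)[OF \<eta>, of 1], of x]
      by (rule_tac DERIV_cong) (auto simp: numeral_2_eq_2 algebra_simps)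
    show "isCont ?f x" for x
    proof -
      have "continuous_on UNIV ?f" using cont by (intro continuous_intros) auto
      then show ?thesis by (simp add: continuous_on_eq_continuous_at)
    qed
    show "set_integrable lborel (einterval (-\<infinity>) \<infinity>) ?f"
      using int by (simp add: set_integrable_def einterval_def)
    show "(((\<lambda>x. \<eta>0 x * ?l 1 x) \<circ> real_of_ereal) \<longlongrightarrow> 0) (at_right (-\<infinity>))"
      unfolding ereal_tendsto_simps by (rule lim) real_asymp
    show "(((\<lambda>x. \<eta>0 x * ?l 1 x) \<circ> real_of_ereal) \<longlongrightarrow> 0) (at_left \<infinity>)"
      unfolding ereal_tendsto_simps by (rule lim) real_asymp
  qed simp
  then have "(\<integral>x. ?f x \<partial>lborel) = 0"
    by (simp add: interval_lebesgue_integral_def set_lebesgue_integral_def einterval_def)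
  then have "(\<integral>x. \<eta>0 x * ?l 2 x \<partial>lborel) = - (\<integral>x. \<eta>0 x * (?l 1 x * ?m 1 x) \<partial>lborel)"
    using int by simp
  then show ?thesis
    by (simp add: integral_error_law info_def ell_dot_eq mult.assoc mult.commute)
qed

end

section \<open>A maximal inequality for weighted indicators\<close>

lemma exp_le_quadratic:
  assumes "\<bar>x :: real\<bar> \<le> 1"
  shows "exp x \<le> 1 + x + x\<^sup>2"
proof (cases "0 \<le> x")
  case True
  then show ?thesis using assms by (intro exp_bound) auto
next
  case False
  define y where "y = - x"
  have y: "0 \<le> y" using False by (simp add: y_def)
  have q: "1 + y + y\<^sup>2 / 2 \<le> exp y" by (rule exp_lower_Taylor_quadratic[OF y])
  have "0 \<le> y\<^sup>2 / 2 + y ^ 3 / 2 + y ^ 4 / 2" using y by simp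
  also have "\<dots> = (1 - y + y\<^sup>2) * (1 + y + y\<^sup>2 / 2) - 1"
    by (simp add: algebra_simps power2_eq_square power3_eq_cube power4_eq_xxxx field_simps)
  finally have "1 \<le> (1 - y + y\<^sup>2) * (1 + y + y\<^sup>2 / 2)" by simp
  also have "\<dots> \<le> (1 - y + y\<^sup>2) * exp y"
  proof (rule mult_left_mono[OF q])
    have "0 \<le> (1 - y)\<^sup>2 + y" using y by simp
    then show "0 \<le> 1 - y + y\<^sup>2" by (simp add: power2_eq_square algebra_simps)
  qed
  finally have "exp (- y) \<le> 1 - y + y\<^sup>2"
    by (simp add: exp_minus inverse_eq_divide divide_le_eq)
  then show ?thesis by (simp add: y_def)
qed

text \<open>
  A Bernstein-type bound: the exponent is proportional to the variance proxy \<open>prob A\<close>. Hoeffding's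
  lemma would give a constant there, and the integral over the tail events in \<open>expected_sup_deviation\<close>
  would diverge.
\<close>

lemma (in prob_space) mgf_centered_indicator:
  assumes A: "A \<in> events" and u: "\<bar>u\<bar> \<le> 1"
  shows "(\<integral>\<^sup>+x. ennreal (exp (u * (indicator A x - prob A))) \<partial>M) \<le> ennreal (exp (u\<^sup>2 * prob A))"
proof -
  let ?v = "prob A"
  have v: "0 \<le> ?v" "?v \<le> 1" by auto
  have pt: "exp (u * (indicator A x - ?v)) \<le> (1 - u * ?v + u\<^sup>2 * ?v\<^sup>2) + (u + u\<^sup>2 - 2 * u\<^sup>2 * ?v) * indicator A x" for x
  proof -
    have "\<bar>indicator A x - ?v\<bar> \<le> 1" using v by (auto simp: indicator_def)
    then have "\<bar>u\<bar> * \<bar>indicator A x - ?v\<bar> \<le> 1 * 1" using u by (intro mult_mono) auto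
    then have "exp (u * (indicator A x - ?v)) \<le> 1 + u * (indicator A x - ?v) + (u * (indicator A x - ?v))\<^sup>2"
      by (intro exp_le_quadratic) (simp add: abs_mult)
    also have "\<dots> = (1 - u * ?v + u\<^sup>2 * ?v\<^sup>2) + (u + u\<^sup>2 - 2 * u\<^sup>2 * ?v) * indicator A x"
      by (simp add: indicator_def power2_eq_square algebra_simps)
    finally show ?thesis .
  qed
  have ind: "integrable M (indicat_real A)"
    using A by (intro integrable_real_indicator) (auto simp: emeasure_eq_measure)
  have int: "integrable M (\<lambda>x. (1 - u * ?v + u\<^sup>2 * ?v\<^sup>2) + (u + u\<^sup>2 - 2 * u\<^sup>2 * ?v) * indicator A x)"
    using ind by simp
  have "(\<integral>\<^sup>+x. ennreal (exp (u * (indicator A x - ?v))) \<partial>M)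
     \<le> (\<integral>\<^sup>+x. ennreal ((1 - u * ?v + u\<^sup>2 * ?v\<^sup>2) + (u + u\<^sup>2 - 2 * u\<^sup>2 * ?v) * indicator A x) \<partial>M)"
    by (intro nn_integral_mono ennreal_leI pt)
  also have "\<dots> = ennreal (\<integral>x. (1 - u * ?v + u\<^sup>2 * ?v\<^sup>2) + (u + u\<^sup>2 - 2 * u\<^sup>2 * ?v) * indicator A x \<partial>M)"
    by (rule nn_integral_eq_integral[OF int]) (auto intro!: AE_I2 order.trans[OF _ pt])
  also have "(\<integral>x. (1 - u * ?v + u\<^sup>2 * ?v\<^sup>2) + (u + u\<^sup>2 - 2 * u\<^sup>2 * ?v) * indicator A x \<partial>M)
      = (1 - u * ?v + u\<^sup>2 * ?v\<^sup>2) + (u + u\<^sup>2 - 2 * u\<^sup>2 * ?v) * ?v"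
    using A ind by (simp add: prob_space)
  also have "\<dots> = 1 + u\<^sup>2 * ?v - u\<^sup>2 * ?v\<^sup>2" by (simp add: algebra_simps power2_eq_square)
  also have "ennreal \<dots> \<le> ennreal (exp (u\<^sup>2 * ?v))"
  proof (rule ennreal_leI)
    have "0 \<le> u\<^sup>2 * ?v\<^sup>2" by simp
    then show "1 + u\<^sup>2 * ?v - u\<^sup>2 * ?v\<^sup>2 \<le> exp (u\<^sup>2 * ?v)"
      using exp_ge_add_one_self[of "u\<^sup>2 * ?v"] by linarith
  qed
  finally show ?thesis .
qed

lemma (in prob_space) mgf_weighted_indicators:
  fixes a :: "nat \<Rightarrow> real"
  assumes A: "A \<in> events" and a: "\<And>i. i < n \<Longrightarrow> \<bar>a i\<bar> \<le> B" and l: "\<bar>l\<bar> * B \<le> 1" "0 \<le> B"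
  shows "(\<integral>\<^sup>+e. ennreal (exp (l * (\<Sum>i<n. a i * (indicator A (e i) - prob A)))) \<partial>PiM {..<n} (\<lambda>_. M))
     \<le> ennreal (exp (l\<^sup>2 * B\<^sup>2 * (real n * prob A)))"
proof -
  interpret PP: product_sigma_finite "\<lambda>_::nat. M"
    by (simp add: product_sigma_finite_def sigma_finite_measure_axioms)
  let ?f = "\<lambda>i x. ennreal (exp (l * a i * (indicator A x - prob A)))"
  have "(\<integral>\<^sup>+e. ennreal (exp (l * (\<Sum>i<n. a i * (indicator A (e i) - prob A)))) \<partial>PiM {..<n} (\<lambda>_. M))
      = (\<integral>\<^sup>+e. (\<Prod>i<n. ?f i (e i)) \<partial>PiM {..<n} (\<lambda>_. M))"
    by (simp add: sum_distrib_left exp_sum prod_ennreal mult.assoc)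
  also have "\<dots> = (\<Prod>i<n. \<integral>\<^sup>+x. ?f i x \<partial>M)"
    using A by (intro PP.product_nn_integral_prod) auto
  also have "\<dots> \<le> (\<Prod>i<n. ennreal (exp (l\<^sup>2 * B\<^sup>2 * prob A)))"
  proof (rule prod_mono_ennreal)
    fix i assume "i \<in> {..<n}"
    then have ai: "\<bar>a i\<bar> \<le> B" using a by simp
    have "\<bar>l * a i\<bar> \<le> \<bar>l\<bar> * B" unfolding abs_mult by (intro mult_left_mono ai) auto
    then have "\<bar>l * a i\<bar> \<le> 1" using l by linarith
    from mgf_centered_indicator[OF A this]
    have "(\<integral>\<^sup>+x. ?f i x \<partial>M) \<le> ennreal (exp ((l * a i)\<^sup>2 * prob A))" .
    also have "\<dots> \<le> ennreal (exp (l\<^sup>2 * B\<^sup>2 * prob A))"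
    proof (intro ennreal_leI exp_le_cancel_iff[THEN iffD2] mult_right_mono)
      have "(a i)\<^sup>2 \<le> B\<^sup>2" using ai l(2) by (intro abs_le_square_iff[THEN iffD1]) auto
      then show "(l * a i)\<^sup>2 \<le> l\<^sup>2 * B\<^sup>2" by (simp add: power_mult_distrib mult_left_mono)
    qed auto
    finally show "(\<integral>\<^sup>+x. ?f i x \<partial>M) \<le> ennreal (exp (l\<^sup>2 * B\<^sup>2 * prob A))" .
  qed
  also have "\<dots> = ennreal (exp (l\<^sup>2 * B\<^sup>2 * (real n * prob A)))"
  proof -
    have "exp (l\<^sup>2 * B\<^sup>2 * (real n * prob A)) = exp (l\<^sup>2 * B\<^sup>2 * prob A) ^ n"
      by (simp only: exp_of_nat_mult[symmetric] mult_ac)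
    then show ?thesis by (simp add: ennreal_power)
  qed
  finally show ?thesis .
qed

text \<open>
  The tangent to the logarithm at \<open>K\<close>, applied to \<open>exp \<bar>x\<bar>\<close>. It is linear in the exponentials, so a
  maximum of absolute values is controlled after integration by moment generating functions alone;
  \<open>K\<close> is chosen as the expected size of the sum of exponentials.
\<close>

lemma abs_le_ln_add_exp:
  fixes x :: real
  assumes "0 < K"
  shows "\<bar>x\<bar> \<le> ln K + (exp x + exp (- x)) / K"
proof -
  have "exp \<bar>x\<bar> \<le> exp x + exp (- x)" by (cases "0 \<le> x") auto
  moreover have "ln (exp \<bar>x\<bar> / K) \<le> exp \<bar>x\<bar> / K - 1"
    using assms by (intro ln_le_minus_one) simp
  moreover have "ln (exp \<bar>x\<bar> / K) = \<bar>x\<bar> - ln K" using assms by (simp add: ln_div)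
  ultimately show ?thesis
    using divide_right_mono[of "exp \<bar>x\<bar>" "exp x + exp (- x)" K] assms by linarith
qed

text \<open>
  Put \<open>w = n * prob A\<close> and \<open>\<Lambda> = ln (2 * card I)\<close>. If \<open>\<Lambda> \<le> w\<close>, exponential moments give the rate
  \<open>sqrt (w * \<Lambda>)\<close>, since the optimal parameter lies in the range where the quadratic bound for the
  exponential holds. If \<open>w < \<Lambda>\<close>, the sum is at most \<open>B\<close> times a number of hits plus its mean, both of
  expectation \<open>w \<le> sqrt (w * \<Lambda>)\<close>. Thus the term \<open>\<Lambda>\<close> that Bernstein's inequality carries in general
  does not appear.
\<close>

lemma (in prob_space) maximal_inequality_indicators:
  fixes a :: "'m \<Rightarrow> nat \<Rightarrow> real"
  assumes A: "A \<in> events" and I: "finite I" "I \<noteq> {}"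
    and a: "\<And>m i. m \<in> I \<Longrightarrow> i < n \<Longrightarrow> \<bar>a m i\<bar> \<le> B" and B: "0 < B"
  shows "(\<integral>\<^sup>+e. (SUP m\<in>I. ennreal \<bar>\<Sum>i<n. a m i * (indicator A (e i) - prob A)\<bar>) \<partial>PiM {..<n} (\<lambda>_. M))
     \<le> ennreal (4 * B * sqrt (real n * prob A * ln (2 * card I)))"
proof -
  let ?P = "PiM {..<n} (\<lambda>_. M)" and ?v = "prob A"
  let ?S = "\<lambda>m e. \<Sum>i<n. a m i * (indicator A (e i) - ?v)"
  define \<Lambda> where "\<Lambda> = ln (2 * real (card I))"
  define w where "w = real n * ?v"
  interpret P: product_prob_space "\<lambda>_::nat. M" "{..<n}"
    by unfold_locales
  have N: "1 \<le> real (card I)" using I by (simp add: Suc_le_eq card_gt_0_iff)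
  have "ln 2 \<le> \<Lambda>" unfolding \<Lambda>_def using N by (subst ln_le_cancel_iff) auto
  moreover have "1 / 2 \<le> ln (2 :: real)" using ln2_ge_two_thirds by linarith
  ultimately have \<Lambda>: "1 / 2 \<le> \<Lambda>" by linarith
  have w0: "0 \<le> w" by (simp add: w_def)
  note [measurable] = A
  have meas [measurable]: "(\<lambda>e. ?S m e) \<in> borel_measurable ?P" for m by measurable
  show ?thesis
  proof (cases "\<Lambda> \<le> w")
    case True
    then have wpos: "0 < w" using \<Lambda> by linarith
    \<comment> \<open>the minimizer of \<open>\<Lambda> / l + l * B\<^sup>2 * w\<close>; the case assumption says exactly that \<open>l * B \<le> 1\<close>\<close>
    define l where "l = sqrt (\<Lambda> / w) / B"
    have lpos: "0 < l" using wpos \<Lambda> B by (simp add: l_def)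
    have lB: "l * B \<le> 1" using True wpos \<Lambda> B by (simp add: l_def)
    have l2: "l\<^sup>2 * B\<^sup>2 * w = \<Lambda>"
      using wpos \<Lambda> B by (simp add: l_def power_divide real_sqrt_pow2)
    \<comment> \<open>an upper bound for the expected sum of the \<open>2 * card I\<close> exponentials\<close>
    define K where "K = 2 * real (card I) * exp \<Lambda>"
    have Kpos: "0 < K" using N by (simp add: K_def)
    have lnK: "ln K = 2 * \<Lambda>" using N by (simp add: K_def ln_mult \<Lambda>_def)
    have K1: "0 \<le> ln K" using lnK \<Lambda> by simp
    have mgf: "(\<integral>\<^sup>+e. ennreal (exp (c * ?S m e)) \<partial>?P) \<le> ennreal (exp \<Lambda>)"
      if "m \<in> I" "c = l \<or> c = - l" for m c
      using mgf_weighted_indicators[where n=n and l=c, OF A a[OF that(1)]] that(2) lpos lB l2 B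
      by (auto simp: w_def)
    have pt: "(SUP m\<in>I. ennreal \<bar>?S m e\<bar>)
        \<le> ennreal (ln K / l) + ennreal (1 / (l * K)) * (\<Sum>m\<in>I. ennreal (exp (l * ?S m e)) + ennreal (exp (- l * ?S m e)))" for e
    proof (rule SUP_least)
      fix m assume m: "m \<in> I"
      have "l * \<bar>?S m e\<bar> \<le> ln K + (exp (l * ?S m e) + exp (- l * ?S m e)) / K"
        using abs_le_ln_add_exp[OF Kpos, of "l * ?S m e"] lpos by (simp add: abs_mult)
      then have "\<bar>?S m e\<bar> \<le> (ln K + (exp (l * ?S m e) + exp (- l * ?S m e)) / K) / l"
        using lpos by (simp add: le_divide_eq mult.commute)
      also have "\<dots> = ln K / l + 1 / (l * K) * (exp (l * ?S m e) + exp (- l * ?S m e))"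
        by (simp add: add_divide_distrib mult.commute)
      finally have "ennreal \<bar>?S m e\<bar> \<le> ennreal (ln K / l + 1 / (l * K) * (exp (l * ?S m e) + exp (- l * ?S m e)))"
        by (rule ennreal_leI)
      also have "\<dots> = ennreal (ln K / l) + ennreal (1 / (l * K)) * (ennreal (exp (l * ?S m e)) + ennreal (exp (- l * ?S m e)))"
        using K1 lpos Kpos
        by (simp only: ennreal_plus[symmetric] ennreal_mult[symmetric] add_nonneg_nonneg exp_ge_zero
            divide_nonneg_nonneg mult_nonneg_nonneg less_imp_le zero_le_one)
      also have "\<dots> \<le> ennreal (ln K / l) + ennreal (1 / (l * K)) * (\<Sum>m\<in>I. ennreal (exp (l * ?S m e)) + ennreal (exp (- l * ?S m e)))"
        using member_le_sum[OF m _ I(1), of "\<lambda>m. ennreal (exp (l * ?S m e)) + ennreal (exp (- l * ?S m e))"]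
        by (intro add_left_mono mult_left_mono) auto
      finally show "ennreal \<bar>?S m e\<bar> \<le> \<dots>" .
    qed
    have "(\<integral>\<^sup>+e. (SUP m\<in>I. ennreal \<bar>?S m e\<bar>) \<partial>?P)
       \<le> (\<integral>\<^sup>+e. ennreal (ln K / l) + ennreal (1 / (l * K)) * (\<Sum>m\<in>I. ennreal (exp (l * ?S m e)) + ennreal (exp (- l * ?S m e))) \<partial>?P)"
      by (rule nn_integral_mono) (rule pt)
    also have "\<dots> = ennreal (ln K / l) + ennreal (1 / (l * K)) *
        (\<Sum>m\<in>I. (\<integral>\<^sup>+e. ennreal (exp (l * ?S m e)) \<partial>?P) + (\<integral>\<^sup>+e. ennreal (exp (- l * ?S m e)) \<partial>?P))"
      by (subst nn_integral_add, measurable, subst nn_integral_cmult, measurable,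
          subst nn_integral_sum, measurable, subst nn_integral_add, measurable)
         (simp add: P.emeasure_space_1)
    also have "\<dots> \<le> ennreal (ln K / l) + ennreal (1 / (l * K)) * (\<Sum>m\<in>I. ennreal (exp \<Lambda>) + ennreal (exp \<Lambda>))"
      by (intro add_left_mono mult_left_mono sum_mono add_mono mgf) auto
    also have "(\<Sum>m\<in>I. ennreal (exp \<Lambda>) + ennreal (exp \<Lambda>)) = ennreal K"
      by (simp add: K_def ennreal_plus[symmetric] ennreal_of_nat_eq_real_of_nat ennreal_mult[symmetric] del: ennreal_plus)
    also have "ennreal (ln K / l) + ennreal (1 / (l * K)) * ennreal K = ennreal ((2 * \<Lambda> + 1) / l)"
      using Kpos lpos K1
      by (simp add: ennreal_mult[symmetric] ennreal_plus[symmetric] lnK add_divide_distrib del: ennreal_plus)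
    also have "\<dots> \<le> ennreal (4 * B * sqrt (w * \<Lambda>))"
    proof (rule ennreal_leI)
      have "(2 * \<Lambda> + 1) / l \<le> (4 * \<Lambda>) / l" using \<Lambda> lpos by (intro divide_right_mono) auto
      also have "\<dots> = 4 * B * (\<Lambda> / sqrt (\<Lambda> / w))" by (simp add: l_def)
      also have "\<Lambda> / sqrt (\<Lambda> / w) = sqrt (w * \<Lambda>)"
        using \<Lambda> wpos by (simp add: real_sqrt_divide real_sqrt_mult field_simps)
      finally show "(2 * \<Lambda> + 1) / l \<le> 4 * B * sqrt (w * \<Lambda>)" .
    qed
    finally show ?thesis by (simp add: w_def \<Lambda>_def)
  next
    case False
    have pt: "(SUP m\<in>I. ennreal \<bar>?S m e\<bar>) \<le> ennreal B * (\<Sum>i<n. indicator A (e i) + ennreal ?v)" for e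
    proof (rule SUP_least)
      fix m assume m: "m \<in> I"
      have "\<bar>?S m e\<bar> \<le> (\<Sum>i<n. \<bar>a m i * (indicator A (e i) - ?v)\<bar>)" by (rule sum_abs)
      also have "\<dots> \<le> (\<Sum>i<n. B * (indicator A (e i) + ?v))"
        unfolding abs_mult using a[OF m] B
        by (intro sum_mono mult_mono) (auto simp: indicator_def)
      finally have "ennreal \<bar>?S m e\<bar> \<le> ennreal (\<Sum>i<n. B * (indicator A (e i) + ?v))" by (rule ennreal_leI)
      also have "\<dots> = ennreal B * (\<Sum>i<n. indicator A (e i) + ennreal ?v)"
        using B by (simp add: sum_distrib_left[symmetric] ennreal_mult sum_ennreal[symmetric] ennreal_indicator sum_nonneg
           del: sum_ennreal)
      finally show "ennreal \<bar>?S m e\<bar> \<le> \<dots>" .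
    qed
    have comp: "(\<integral>\<^sup>+e. indicator A (e i) \<partial>?P) = ennreal ?v" if "i < n" for i
    proof -
      have "(\<integral>\<^sup>+e. indicator A (e i) \<partial>?P) = (\<integral>\<^sup>+x. indicator A x \<partial>distr ?P M (\<lambda>e. e i))"
        using that by (subst nn_integral_distr) auto
      also have "distr ?P M (\<lambda>e. e i) = M" using that by (intro P.PiM_component) simp
      finally show ?thesis by (simp add: emeasure_eq_measure)
    qed
    have "(\<integral>\<^sup>+e. (SUP m\<in>I. ennreal \<bar>?S m e\<bar>) \<partial>?P)
        \<le> (\<integral>\<^sup>+e. ennreal B * (\<Sum>i<n. indicator A (e i) + ennreal ?v) \<partial>?P)"
      by (rule nn_integral_mono) (rule pt)
    also have "\<dots> = ennreal B * (\<Sum>i<n. ennreal ?v + ennreal ?v)"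
    proof -
      have m: "(\<lambda>e. indicator A (e i) :: ennreal) \<in> borel_measurable ?P" if "i < n" for i
      proof -
        have "i \<in> {..<n}" using that by simp
        then show ?thesis by measurable
      qed
      have "(\<integral>\<^sup>+e. indicator A (e i) + ennreal ?v \<partial>?P) = ennreal ?v + ennreal ?v" if "i < n" for i
        using comp[OF that] m[OF that] by (subst nn_integral_add) (auto simp: P.emeasure_space_1)
      then show ?thesis
        using m by (subst nn_integral_cmult nn_integral_sum; auto)+
    qed
    also have "\<dots> = ennreal (2 * B * w)"
      using B by (simp add: w_def ennreal_plus[symmetric] ennreal_of_nat_eq_real_of_nat ennreal_mult[symmetric] algebra_simps del: ennreal_plus)
    also have "\<dots> \<le> ennreal (4 * B * sqrt (w * \<Lambda>))"
    proof (rule ennreal_leI)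
      have "w * w \<le> w * \<Lambda>" using False w0 by (intro mult_left_mono) auto
      then have "w \<le> sqrt (w * \<Lambda>)" using w0 by (intro real_le_rsqrt) (simp add: power2_eq_square)
      then have "(2 * B) * w \<le> (4 * B) * sqrt (w * \<Lambda>)" using B w0 by (intro mult_mono) auto
      then show "2 * B * w \<le> 4 * B * sqrt (w * \<Lambda>)" .
    qed
    finally show ?thesis by (simp add: w_def \<Lambda>_def)
  qed
qed

section \<open>Deviations uniform over smooth functions\<close>

text \<open>
  The half-line that starts at \<open>t\<close> and points away from the origin. Oriented this way, its probability
  is small for \<open>t\<close> large of either sign.
\<close>

definition tail_set :: "real \<Rightarrow> real set" where
  "tail_set t = {x. 0 \<le> t \<and> t < x \<or> t < 0 \<and> x \<le> t}"

lemma tail_set_measurable [measurable]: "tail_set t \<in> sets borel"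
  unfolding tail_set_def by measurable

lemma tail_set_indicator_measurable [measurable (raw)]:
  assumes [measurable]: "f \<in> borel_measurable M" "g \<in> borel_measurable M"
  shows "(\<lambda>p. indicat_real (tail_set (f p)) (g p)) \<in> borel_measurable M"
proof -
  have "(\<lambda>p. if 0 \<le> f p \<and> f p < g p \<or> f p < 0 \<and> g p \<le> f p then 1 else 0 :: real) \<in> borel_measurable M"
    by measurable
  then show ?thesis by (simp add: tail_set_def indicator_def of_bool_def)
qed

lemma tail_set_pred_measurable [measurable (raw)]:
  assumes [measurable]: "f \<in> borel_measurable M" "g \<in> borel_measurable M"
  shows "Measurable.pred M (\<lambda>p. g p \<in> tail_set (f p))"
  unfolding tail_set_def mem_Collect_eq by measurable

text \<open>
  The fundamental theorem of calculus from \<open>0\<close> to \<open>y\<close>, with the interval of integration expressed by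
  membership of \<open>y\<close> in half-lines; the sign accounts for the orientation when \<open>y\<close> is negative.
\<close>

lemma integral_tail_set:
  fixes f f' :: "real \<Rightarrow> real"
  assumes der: "\<And>x. (f has_real_derivative f' x) (at x)" and cont: "continuous_on UNIV f'"
  shows "(\<integral>t. (if 0 \<le> t then 1 else - 1) * f' t * indicator (tail_set t) y \<partial>lborel) = f y - f 0"
proof -
  have [measurable]: "f' \<in> borel_measurable borel" by (rule borel_measurable_continuous_onI[OF cont])
  have ftc: "(\<integral>t. f' t * indicator {a..b} t \<partial>lborel) = f b - f a" if "a \<le> b" for a b
    using that der cont by (intro integral_FTC_Icc_real) (auto simp: continuous_on_eq_continuous_at)
  have ne: "AE t in lborel. t \<noteq> y" by (rule AE_lborel_singleton)
  show ?thesis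
  proof (cases "0 \<le> y")
    case True
    have "(\<integral>t. (if 0 \<le> t then 1 else - 1) * f' t * indicator (tail_set t) y \<partial>lborel)
        = (\<integral>t. f' t * indicator {0..y} t \<partial>lborel)"
    proof (rule integral_cong_AE)
      show "AE t in lborel. (if 0 \<le> t then 1 else - 1) * f' t * indicator (tail_set t) y
          = f' t * indicator {0..y} t"
        using ne by eventually_elim (use True in \<open>auto simp: tail_set_def indicator_def\<close>)
    qed measurable
    then show ?thesis using ftc[OF True] by simp
  next
    case False
    have ne0: "AE t in lborel. t \<noteq> (0::real)" by (rule AE_lborel_singleton)
    have "(\<integral>t. (if 0 \<le> t then 1 else - 1) * f' t * indicator (tail_set t) y \<partial>lborel)
        = (\<integral>t. - (f' t * indicator {y..0} t) \<partial>lborel)"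
    proof (rule integral_cong_AE)
      show "AE t in lborel. (if 0 \<le> t then 1 else - 1) * f' t * indicator (tail_set t) y
          = - (f' t * indicator {y..0} t)"
        using ne0 by eventually_elim (use False in \<open>auto simp: tail_set_def indicator_def\<close>)
    qed measurable
    then show ?thesis using ftc[of y 0] False by simp
  qed
qed

context tame_error
begin

abbreviation tail_prob :: "real \<Rightarrow> real" where
  "tail_prob t \<equiv> error.prob (tail_set t)"

lemma tail_prob_measurable [measurable]: "tail_prob \<in> borel_measurable borel"
proof -
  have "(\<lambda>t. \<integral>x. indicat_real (tail_set t) x \<partial>error_law \<eta>0) \<in> borel_measurable borel"
    by measurable
  then show ?thesis by simp
qed

text \<open>
  Markov's inequality for the weight \<open>(1 + x\<^sup>2) ^ 6\<close>.
\<close>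

lemma tail_prob_le: "tail_prob t \<le> A * pi / (1 + t\<^sup>2) ^ 6"
proof -
  have pos: "0 < 1 + t\<^sup>2" by (rule add_pos_nonneg) auto
  have "\<bar>\<integral>x. (1 + t\<^sup>2) ^ 6 * indicat_real (tail_set t) x \<partial>error_law \<eta>0\<bar> \<le> A * 1 * pi"
  proof (rule integral_error_law_le)
    fix x
    show "\<bar>(1 + t\<^sup>2) ^ 6 * indicat_real (tail_set t) x\<bar> \<le> 1 * (1 + x\<^sup>2) ^ 7"
    proof (cases "x \<in> tail_set t")
      case True
      then have "\<bar>t\<bar> \<le> \<bar>x\<bar>" by (auto simp: tail_set_def)
      then have "t\<^sup>2 \<le> x\<^sup>2" by (simp add: abs_le_square_iff)
      then have "(1 + t\<^sup>2) ^ 6 \<le> (1 + x\<^sup>2) ^ 6" by (intro power_mono) auto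
      also have "\<dots> \<le> (1 + x\<^sup>2) ^ 7" by (rule power_increasing) auto
      finally show ?thesis using True by simp
    qed simp
  qed simp
  then have "(1 + t\<^sup>2) ^ 6 * tail_prob t \<le> A * pi" by simp
  then show ?thesis using pos by (simp add: le_divide_eq mult.commute)
qed

definition tail_deviation :: "nat \<Rightarrow> (nat \<Rightarrow> real) \<Rightarrow> real \<Rightarrow> (nat \<Rightarrow> real) \<Rightarrow> real" where
  "tail_deviation n a t e = (\<Sum>i<n. a i * (indicator (tail_set t) (e i) - tail_prob t))"

lemma tail_deviation_measurable:
  "(\<lambda>(t, e). tail_deviation n a t e) \<in> borel_measurable (borel \<Otimes>\<^sub>M PiM {..<n} (\<lambda>_. error_law \<eta>0))"
  unfolding tail_deviation_def split_beta' by measurable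

text \<open>
  Fubini's theorem applied to the representation in \<open>integral_tail_set\<close>: the value \<open>f 0\<close> cancels in the
  centring, and the mean of \<open>f\<close> becomes the same integral with the indicators replaced by their
  probabilities. The right-hand side depends on \<open>f\<close> only through the constant \<open>B\<close>, so the inequality
  holds simultaneously for all functions whose derivative obeys the same growth bound.
\<close>

lemma centered_sum_le_tail_deviation:
  fixes f f' :: "real \<Rightarrow> real"
  assumes der: "\<And>x. (f has_real_derivative f' x) (at x)" and cont: "continuous_on UNIV f'"
    and growth: "\<And>x. \<bar>f' x\<bar> \<le> B * (1 + x\<^sup>2)\<^sup>2" and int: "integrable (error_law \<eta>0) f" and B: "0 \<le> B"
  shows "ennreal \<bar>\<Sum>i<n. a i * (f (e i) - (\<integral>x. f x \<partial>error_law \<eta>0))\<bar>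
    \<le> ennreal B * (\<integral>\<^sup>+t. ennreal ((1 + t\<^sup>2)\<^sup>2) * ennreal \<bar>tail_deviation n a t e\<bar> \<partial>lborel)"
proof -
  define g where "g t = (if 0 \<le> t then 1 else - 1) * f' t" for t :: real
  have [measurable]: "f' \<in> borel_measurable borel" by (rule borel_measurable_continuous_onI[OF cont])
  then have [measurable]: "g \<in> borel_measurable borel" unfolding g_def[abs_def] by measurable
  have abs_g: "\<bar>g t\<bar> = \<bar>f' t\<bar>" for t by (simp add: g_def)
  have rep: "(\<integral>t. g t * indicator (tail_set t) y \<partial>lborel) = f y - f 0" for y
    using integral_tail_set[OF der cont] by (simp add: g_def)
  have rep_int: "integrable lborel (\<lambda>t. g t * indicator (tail_set t) y)" for y
  proof -
    have "set_integrable lborel {- \<bar>y\<bar>..\<bar>y\<bar>} f'"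
      by (rule borel_integrable_atLeastAtMost') (rule continuous_on_subset[OF cont], simp)
    then show ?thesis unfolding set_integrable_def
      by (rule Bochner_Integration.integrable_bound)
         (auto simp: abs_mult abs_g tail_set_def indicator_def)
  qed
  have g_tail: "integrable lborel (\<lambda>t. g t * tail_prob t)"
  proof (rule integrable_lborel_of_decay)
    fix t :: real
    have pos: "0 < 1 + t\<^sup>2" by (rule add_pos_nonneg) auto
    have A0: "0 \<le> A" by (rule tame_density_nonneg_const[OF tame])
    have "\<bar>g t * tail_prob t\<bar> \<le> B * (1 + t\<^sup>2)\<^sup>2 * (A * pi / (1 + t\<^sup>2) ^ 6)"
      unfolding abs_mult abs_g using growth[of t] tail_prob_le[of t] B by (intro mult_mono) auto
    also have "\<dots> = B * (A * pi) / (1 + t\<^sup>2) ^ 4"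
      using pos by (simp add: divide_simps eval_nat_numeral)
    also have "\<dots> \<le> B * (A * pi) / (1 + t\<^sup>2) ^ 1"
      using A0 B pos by (intro divide_left_mono power_increasing mult_pos_pos zero_less_power) auto
    finally show "\<bar>g t * tail_prob t\<bar> \<le> B * (A * pi) / (1 + t\<^sup>2)" by simp
  qed measurable
  interpret pair_sigma_finite lborel "error_law \<eta>0"
    by (intro pair_sigma_finite.intro sigma_finite_lborel) unfold_locales
  have "integrable (lborel \<Otimes>\<^sub>M error_law \<eta>0) (\<lambda>(t, x). g t * indicator (tail_set t) x)"
  proof (rule Fubini_integrable)
    show "(\<lambda>(t, x). g t * indicator (tail_set t) x) \<in> borel_measurable (lborel \<Otimes>\<^sub>M error_law \<eta>0)"
      unfolding split_beta' by measurable
    have "(\<integral>x. norm (case (t, x) of (t, x) \<Rightarrow> g t * indicator (tail_set t) x) \<partial>error_law \<eta>0) = \<bar>g t * tail_prob t\<bar>" for t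
      by (simp add: abs_mult)
    then show "integrable lborel (\<lambda>t. \<integral>x. norm (case (t, x) of (t, x) \<Rightarrow> g t * indicator (tail_set t) x) \<partial>error_law \<eta>0)"
      using integrable_abs[OF g_tail] by presburger
    show "AE t in lborel. integrable (error_law \<eta>0) (\<lambda>x. case (t, x) of (t, x) \<Rightarrow> g t * indicator (tail_set t) x)"
      by (intro AE_I2) (auto intro!: integrable_mult_right integrable_real_indicator simp: error.emeasure_eq_measure)
  qed
  from Fubini_integral[OF this[unfolded case_prod_beta' [symmetric]]]
  have "(\<integral>x. f x - f 0 \<partial>error_law \<eta>0) = (\<integral>t. g t * tail_prob t \<partial>lborel)"
    by (simp add: rep)
  then have mean: "(\<integral>x. f x \<partial>error_law \<eta>0) = f 0 + (\<integral>t. g t * tail_prob t \<partial>lborel)"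
    using int error.prob_space by simp
  have term_int: "integrable lborel (\<lambda>t. a i * (g t * indicator (tail_set t) (e i) - g t * tail_prob t))" for i
    using rep_int g_tail by (intro integrable_mult_right Bochner_Integration.integrable_diff)
  have eq: "g t * tail_deviation n a t e
      = (\<Sum>i<n. a i * (g t * indicator (tail_set t) (e i) - g t * tail_prob t))" for t
    by (simp add: tail_deviation_def sum_distrib_left algebra_simps)
  have "(\<Sum>i<n. a i * (f (e i) - (\<integral>x. f x \<partial>error_law \<eta>0)))
      = (\<Sum>i<n. \<integral>t. a i * (g t * indicator (tail_set t) (e i) - g t * tail_prob t) \<partial>lborel)"
    using rep_int g_tail by (simp add: mean rep diff_diff_eq)
  also have "\<dots> = (\<integral>t. g t * tail_deviation n a t e \<partial>lborel)"
    unfolding eq using term_int by (rule Bochner_Integration.integral_sum[symmetric])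
  finally have "ennreal \<bar>\<Sum>i<n. a i * (f (e i) - (\<integral>x. f x \<partial>error_law \<eta>0))\<bar>
      = ennreal (norm (\<integral>t. g t * tail_deviation n a t e \<partial>lborel))" by simp
  also have "\<dots> \<le> (\<integral>\<^sup>+t. ennreal (norm (g t * tail_deviation n a t e)) \<partial>lborel)"
    unfolding eq using term_int by (intro integral_norm_bound_ennreal Bochner_Integration.integrable_sum)
  also have "\<dots> \<le> (\<integral>\<^sup>+t. ennreal B * (ennreal ((1 + t\<^sup>2)\<^sup>2) * ennreal \<bar>tail_deviation n a t e\<bar>) \<partial>lborel)"
  proof (rule nn_integral_mono)
    fix t :: real
    have "norm (g t * tail_deviation n a t e) \<le> B * (1 + t\<^sup>2)\<^sup>2 * \<bar>tail_deviation n a t e\<bar>"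
      unfolding real_norm_def abs_mult abs_g by (intro mult_right_mono growth) simp
    then show "ennreal (norm (g t * tail_deviation n a t e))
       \<le> ennreal B * (ennreal ((1 + t\<^sup>2)\<^sup>2) * ennreal \<bar>tail_deviation n a t e\<bar>)"
      using B by (simp add: ennreal_mult[symmetric] ennreal_leI mult.assoc)
  qed
  also have "\<dots> = ennreal B * (\<integral>\<^sup>+t. ennreal ((1 + t\<^sup>2)\<^sup>2) * ennreal \<bar>tail_deviation n a t e\<bar> \<partial>lborel)"
    by (rule nn_integral_cmult) (simp add: tail_deviation_def)
  finally show ?thesis .
qed

definition sup_deviation :: "nat \<Rightarrow> 'm set \<Rightarrow> ('m \<Rightarrow> nat \<Rightarrow> real) \<Rightarrow> (nat \<Rightarrow> real) \<Rightarrow> ennreal" where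
  "sup_deviation n I a e =
     (\<integral>\<^sup>+t. ennreal ((1 + t\<^sup>2)\<^sup>2) * (SUP m\<in>I. ennreal \<bar>tail_deviation n (a m) t e\<bar>) \<partial>lborel)"

lemma sup_deviation_upper:
  assumes "m \<in> I"
  shows "(\<integral>\<^sup>+t. ennreal ((1 + t\<^sup>2)\<^sup>2) * ennreal \<bar>tail_deviation n (a m) t e\<bar> \<partial>lborel) \<le> sup_deviation n I a e"
  unfolding sup_deviation_def
  by (intro nn_integral_mono mult_left_mono SUP_upper assms) auto

lemma sup_deviation_integrand_measurable:
  assumes "finite I"
  shows "(\<lambda>(t, e). ennreal ((1 + t\<^sup>2)\<^sup>2) * (SUP m\<in>I. ennreal \<bar>tail_deviation n (a m) t e\<bar>))
    \<in> borel_measurable (borel \<Otimes>\<^sub>M PiM {..<n} (\<lambda>_. error_law \<eta>0))"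
proof -
  have "(\<lambda>p. SUP m\<in>I. ennreal \<bar>tail_deviation n (a m) (fst p) (snd p)\<bar>)
      \<in> borel_measurable (borel \<Otimes>\<^sub>M PiM {..<n} (\<lambda>_. error_law \<eta>0))"
    using assms tail_deviation_measurable[unfolded split_beta']
    by (intro borel_measurable_SUP countable_finite) auto
  then show ?thesis unfolding split_beta' by measurable
qed

lemma sup_deviation_measurable:
  assumes "finite I"
  shows "sup_deviation n I a \<in> borel_measurable (PiM {..<n} (\<lambda>_. error_law \<eta>0))"
proof -
  have "(\<lambda>(e, t). ennreal ((1 + t\<^sup>2)\<^sup>2) * (SUP m\<in>I. ennreal \<bar>tail_deviation n (a m) t e\<bar>))
    \<in> borel_measurable (PiM {..<n} (\<lambda>_. error_law \<eta>0) \<Otimes>\<^sub>M lborel)"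
    using measurable_compose[OF measurable_pair_swap' sup_deviation_integrand_measurable[OF assms, of n a]]
    by (simp add: split_beta' measurable_cong_sets[OF sets_pair_measure_cong[OF refl sets_lborel] refl])
  from sigma_finite_measure.borel_measurable_nn_integral[OF sigma_finite_lborel this]
  show ?thesis unfolding sup_deviation_def[abs_def] by simp
qed

text \<open>
  By Tonelli's theorem the maximal inequality may be applied for each \<open>t\<close> separately. With \<open>tail_prob_le\<close>
  the product of the weight and the square root of the tail probability is of order
  \<open>(1 + t\<^sup>2)\<^sup>2 / (1 + t\<^sup>2) ^ 3\<close>.
\<close>

lemma expected_sup_deviation:
  assumes I: "finite I" "I \<noteq> {}"
    and a: "\<And>m i. m \<in> I \<Longrightarrow> i < n \<Longrightarrow> \<bar>a m i\<bar> \<le> B" and B: "0 < B"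
  shows "(\<integral>\<^sup>+e. sup_deviation n I a e \<partial>PiM {..<n} (\<lambda>_. error_law \<eta>0))
     \<le> ennreal (4 * pi * sqrt (A * pi) * B * sqrt (real n * ln (2 * card I)))"
proof -
  let ?P = "PiM {..<n} (\<lambda>_. error_law \<eta>0)"
  let ?r = "4 * B * sqrt (real n * ln (2 * card I)) * sqrt (A * pi)"
  have A0: "0 \<le> A" by (rule tame_density_nonneg_const[OF tame])
  have "1 \<le> card I" using I by (simp add: Suc_le_eq card_gt_0_iff)
  then have \<Lambda>0: "0 \<le> ln (2 * real (card I))" by (intro ln_ge_zero) linarith
  interpret P: product_prob_space "\<lambda>_::nat. error_law \<eta>0" "{..<n}" by unfold_locales
  interpret pair_sigma_finite lborel ?P
    by (intro pair_sigma_finite.intro sigma_finite_lborel) unfold_locales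
  have "(\<integral>\<^sup>+e. sup_deviation n I a e \<partial>?P) =
      (\<integral>\<^sup>+t. \<integral>\<^sup>+e. ennreal ((1 + t\<^sup>2)\<^sup>2) * (SUP m\<in>I. ennreal \<bar>tail_deviation n (a m) t e\<bar>) \<partial>?P \<partial>lborel)"
    unfolding sup_deviation_def
    by (rule Fubini')
       (use sup_deviation_integrand_measurable[OF I(1)] in
         \<open>simp add: measurable_cong_sets[OF sets_pair_measure_cong[OF sets_lborel refl] refl]\<close>)
  also have "\<dots> \<le> (\<integral>\<^sup>+t. ennreal (?r * (1 / (1 + t\<^sup>2))) \<partial>lborel)"
  proof (rule nn_integral_mono)
    fix t :: real
    have pos: "0 < 1 + t\<^sup>2" by (rule add_pos_nonneg) auto
    have "(\<lambda>e. SUP m\<in>I. ennreal \<bar>tail_deviation n (a m) t e\<bar>) \<in> borel_measurable ?P"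
      unfolding tail_deviation_def using I by (intro borel_measurable_SUP countable_finite) measurable
    then have "(\<integral>\<^sup>+e. ennreal ((1 + t\<^sup>2)\<^sup>2) * (SUP m\<in>I. ennreal \<bar>tail_deviation n (a m) t e\<bar>) \<partial>?P)
      = ennreal ((1 + t\<^sup>2)\<^sup>2) * (\<integral>\<^sup>+e. (SUP m\<in>I. ennreal \<bar>tail_deviation n (a m) t e\<bar>) \<partial>?P)"
      by (rule nn_integral_cmult)
    also have "\<dots> \<le> ennreal ((1 + t\<^sup>2)\<^sup>2) * ennreal (4 * B * sqrt (real n * tail_prob t * ln (2 * card I)))"
      unfolding tail_deviation_def
      by (intro mult_left_mono error.maximal_inequality_indicators I a B) auto
    also have "\<dots> = ennreal ((1 + t\<^sup>2)\<^sup>2 * (4 * B * sqrt (real n * tail_prob t * ln (2 * card I))))"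
      using B \<Lambda>0 by (simp add: ennreal_mult)
    also have "\<dots> \<le> ennreal (?r * (1 / (1 + t\<^sup>2)))"
    proof (rule ennreal_leI)
      have "sqrt (real n * tail_prob t * ln (2 * card I)) = sqrt (real n * ln (2 * card I)) * sqrt (tail_prob t)"
        by (simp add: real_sqrt_mult)
      also have "\<dots> \<le> sqrt (real n * ln (2 * card I)) * sqrt (A * pi / (1 + t\<^sup>2) ^ 6)"
        using \<Lambda>0 by (intro mult_left_mono real_sqrt_le_mono tail_prob_le) auto
      also have "sqrt (A * pi / (1 + t\<^sup>2) ^ 6) = sqrt (A * pi) / (1 + t\<^sup>2) ^ 3"
      proof -
        have "sqrt ((1 + t\<^sup>2) ^ 6) = (1 + t\<^sup>2) ^ 3"
          using pos by (intro real_sqrt_unique) (auto simp flip: power_mult)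
        then show ?thesis using pos by (simp add: real_sqrt_divide)
      qed
      finally have "(1 + t\<^sup>2)\<^sup>2 * (4 * B * sqrt (real n * tail_prob t * ln (2 * card I)))
          \<le> (1 + t\<^sup>2)\<^sup>2 * (4 * B * (sqrt (real n * ln (2 * card I)) * (sqrt (A * pi) / (1 + t\<^sup>2) ^ 3)))"
        using B by (intro mult_left_mono) auto
      also have "\<dots> = ?r * (1 / (1 + t\<^sup>2))"
        using pos by (simp add: divide_simps eval_nat_numeral)
      finally show "(1 + t\<^sup>2)\<^sup>2 * (4 * B * sqrt (real n * tail_prob t * ln (2 * card I))) \<le> ?r * (1 / (1 + t\<^sup>2))" .
    qed
    finally show "(\<integral>\<^sup>+e. ennreal ((1 + t\<^sup>2)\<^sup>2) * (SUP m\<in>I. ennreal \<bar>tail_deviation n (a m) t e\<bar>) \<partial>?P)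
       \<le> ennreal (?r * (1 / (1 + t\<^sup>2)))" .
  qed
  also have "\<dots> = ennreal (\<integral>t. ?r * (1 / (1 + t\<^sup>2)) \<partial>lborel)"
    using B \<Lambda>0 A0
    by (intro nn_integral_eq_integral integrable_mult_right integrable_inverse_one_plus_square AE_I2)
       (auto intro!: mult_nonneg_nonneg)
  also have "(\<integral>t. ?r * (1 / (1 + t\<^sup>2)) \<partial>lborel) = ?r * pi"
    by (subst integral_mult_right_zero) (simp only: integral_inverse_one_plus_square)
  also have "?r * pi = 4 * pi * sqrt (A * pi) * B * sqrt (real n * ln (2 * card I))" by simp
  finally show ?thesis .
qed

end

section \<open>The quadratic expansion of the log-likelihood\<close>

text \<open>
  For \<open>\<bar>h\<bar> \<le> 1\<close> this is Taylor's theorem with the third-order remainder. For larger \<open>h\<close> the intermediate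
  point could be far out, and that remainder would be of order \<open>h ^ 6\<close>; instead the increment of the
  log-density is bounded by the linear growth of its derivative, and the other two terms directly. The
  result is only quadratic in \<open>h\<close>, as required when \<open>\<epsilon>\<close> is not small.
\<close>

lemma log_density_taylor:
  assumes \<eta>: "tame_density A \<eta>"
  shows "\<bar>ell \<eta> (e - h) - ell \<eta> e + h * log_deriv \<eta> 1 e - h\<^sup>2 / 2 * log_deriv \<eta> 2 e\<bar>
    \<le> 7 * A * min 1 \<bar>h\<bar> * (h\<^sup>2 * (1 + e\<^sup>2)\<^sup>2)"
    (is "\<bar>?R\<bar> \<le> _")
proof (cases "\<bar>h\<bar> \<le> 1")
  case True
  have A0: "0 \<le> A" by (rule tame_density_nonneg_const[OF \<eta>])
  show ?thesis
  proof (cases "h = 0")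
    case False
    have "\<exists>t. (if e - h < e then e - h < t \<and> t < e else e < t \<and> t < e - h) \<and>
        ell \<eta> (e - h) = (\<Sum>m<3. log_deriv \<eta> m e / fact m * (e - h - e) ^ m)
          + log_deriv \<eta> 3 t / fact 3 * (e - h - e) ^ 3"
    proof (rule Taylor[where a="min e (e - h)" and b="max e (e - h)"])
      show "log_deriv \<eta> 0 = ell \<eta>" by (simp add: log_deriv_def)
      show "\<forall>m t. m < 3 \<and> min e (e - h) \<le> t \<and> t \<le> max e (e - h) \<longrightarrow>
          (log_deriv \<eta> m has_real_derivative log_deriv \<eta> (Suc m) t) (at t)"
        using tame_densityD(5)[OF \<eta>] by blast
    qed (use False in auto)
    then obtain t where t: "if e - h < e then e - h < t \<and> t < e else e < t \<and> t < e - h"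
      and eq: "ell \<eta> (e - h) = (\<Sum>m<3. log_deriv \<eta> m e / fact m * (e - h - e) ^ m)
          + log_deriv \<eta> 3 t / fact 3 * (e - h - e) ^ 3" by blast
    have "ell \<eta> (e - h) = ell \<eta> e - h * log_deriv \<eta> 1 e + h\<^sup>2 / 2 * log_deriv \<eta> 2 e - log_deriv \<eta> 3 t / 6 * h ^ 3"
    proof -
      have "log_deriv \<eta> 0 = ell \<eta>" by (simp add: log_deriv_def)
      moreover have "(\<Sum>m<3. F m) = F 0 + F 1 + F 2" for F :: "nat \<Rightarrow> real"
        by (simp add: numeral_3_eq_3 numeral_2_eq_2)
      moreover have "fact 3 = (6 :: real)" "fact 2 = (2 :: real)" by (simp_all add: fact_numeral)
      moreover have "e - h - e = - h" "(- h) ^ 3 = - (h ^ 3)" by simp_all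
      ultimately show ?thesis unfolding eq by simp
    qed
    then have "?R = - (log_deriv \<eta> 3 t / 6 * h ^ 3)" by linarith
    then have R: "\<bar>?R\<bar> = \<bar>h\<bar> ^ 3 / 6 * \<bar>log_deriv \<eta> 3 t\<bar>"
      by (simp add: abs_mult power_abs)
    have "\<bar>t\<bar> \<le> \<bar>e\<bar> + 1" using t True by (auto split: if_splits)
    then have "(1 + \<bar>t\<bar>) ^ 3 \<le> (2 * (1 + \<bar>e\<bar>)) ^ 3" by (intro power_mono) auto
    also have "\<dots> = 8 * (1 + \<bar>e\<bar>) ^ 3" unfolding power_mult_distrib by simp
    also have "\<dots> \<le> 32 * (1 + e\<^sup>2)\<^sup>2" using one_plus_abs_le(3)[of e] by simp
    finally have "\<bar>log_deriv \<eta> 3 t\<bar> \<le> A * (32 * (1 + e\<^sup>2)\<^sup>2)"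
      using order.trans[OF tame_densityD(7)[OF \<eta>, of 3 t] mult_left_mono[OF _ A0]] by simp
    then have "\<bar>?R\<bar> \<le> \<bar>h\<bar> ^ 3 / 6 * (A * (32 * (1 + e\<^sup>2)\<^sup>2))"
      unfolding R by (rule mult_left_mono) simp
    also have "\<dots> = (32 / 6) * (A * (\<bar>h\<bar> ^ 3 * (1 + e\<^sup>2)\<^sup>2))" by simp
    also have "\<dots> \<le> 7 * (A * (\<bar>h\<bar> ^ 3 * (1 + e\<^sup>2)\<^sup>2))" using A0 by (intro mult_right_mono) auto
    also have "\<bar>h\<bar> ^ 3 = min 1 \<bar>h\<bar> * h\<^sup>2" using True by (simp add: power3_eq_cube power2_eq_square)
    finally show ?thesis by (simp add: mult_ac)
  qed simp
next
  case False
  have A0: "0 \<le> A" by (rule tame_density_nonneg_const[OF \<eta>])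
  have hh: "\<bar>h\<bar> \<le> h\<^sup>2"
    using False mult_right_mono[of 1 "\<bar>h\<bar>" "\<bar>h\<bar>"] by (simp add: power2_eq_square)
  have l1: "\<bar>log_deriv \<eta> 1 x\<bar> \<le> A * (1 + \<bar>x\<bar>)" for x
    using tame_densityD(7)[OF \<eta>, of 1 x] by simp
  have "norm (ell \<eta> (e - h) - ell \<eta> e) \<le> A * (1 + \<bar>e\<bar> + \<bar>h\<bar>) * norm ((e - h) - e)"
  proof (rule field_differentiable_bound[where f="ell \<eta>" and x="e - h" and y=e and S="{e - \<bar>h\<bar>..e + \<bar>h\<bar>}" and f'="log_deriv \<eta> 1"])
    fix z assume z: "z \<in> {e - \<bar>h\<bar>..e + \<bar>h\<bar>}"
    have "(ell \<eta> has_real_derivative log_deriv \<eta> 1 z) (at z)"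
      using tame_densityD(5)[OF \<eta>, of 0 z] by (simp add: log_deriv_def)
    then show "(ell \<eta> has_field_derivative log_deriv \<eta> 1 z) (at z within {e - \<bar>h\<bar>..e + \<bar>h\<bar>})"
      by (rule has_field_derivative_at_within)
    have "\<bar>z\<bar> \<le> \<bar>e\<bar> + \<bar>h\<bar>" using z by auto
    then have "A * (1 + \<bar>z\<bar>) \<le> A * (1 + \<bar>e\<bar> + \<bar>h\<bar>)" using A0 by (intro mult_left_mono) auto
    then show "norm (log_deriv \<eta> 1 z) \<le> A * (1 + \<bar>e\<bar> + \<bar>h\<bar>)" using l1[of z] by simp
  qed auto
  then have "\<bar>ell \<eta> (e - h) - ell \<eta> e\<bar> \<le> A * (1 + \<bar>e\<bar> + \<bar>h\<bar>) * \<bar>h\<bar>" by simp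
  also have "\<dots> = A * ((1 + \<bar>e\<bar>) * \<bar>h\<bar> + h\<^sup>2)"
    by (simp add: distrib_left distrib_right power2_eq_square mult.assoc)
  also have "\<dots> \<le> A * ((1 + \<bar>e\<bar>) * h\<^sup>2 + (1 + \<bar>e\<bar>) * h\<^sup>2)"
  proof (rule mult_left_mono[OF add_mono A0])
    show "(1 + \<bar>e\<bar>) * \<bar>h\<bar> \<le> (1 + \<bar>e\<bar>) * h\<^sup>2" using hh by (rule mult_left_mono) simp
    show "h\<^sup>2 \<le> (1 + \<bar>e\<bar>) * h\<^sup>2" by (simp add: distrib_right)
  qed
  finally have 1: "\<bar>ell \<eta> (e - h) - ell \<eta> e\<bar> \<le> 2 * (A * h\<^sup>2 * (1 + \<bar>e\<bar>))"
    by (simp only: mult_ac mult_2_right[symmetric])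
  have "\<bar>h * log_deriv \<eta> 1 e\<bar> \<le> h\<^sup>2 * (A * (1 + \<bar>e\<bar>))"
    unfolding abs_mult using hh l1 by (intro mult_mono) auto
  then have 2: "\<bar>h * log_deriv \<eta> 1 e\<bar> \<le> A * h\<^sup>2 * (1 + \<bar>e\<bar>)" by (simp only: mult_ac)
  have "\<bar>h\<^sup>2 / 2 * log_deriv \<eta> 2 e\<bar> \<le> h\<^sup>2 / 2 * (A * (1 + \<bar>e\<bar>)\<^sup>2)"
    unfolding abs_mult using tame_densityD(7)[OF \<eta>, of 2 e] by (intro mult_mono) auto
  then have 3: "\<bar>h\<^sup>2 / 2 * log_deriv \<eta> 2 e\<bar> \<le> A * h\<^sup>2 * (1 + \<bar>e\<bar>)\<^sup>2 / 2" by (simp only: times_divide_eq_left times_divide_eq_right mult_ac)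
  have Ah: "0 \<le> A * h\<^sup>2" using A0 by simp
  have "\<bar>x + y - z\<bar> \<le> \<bar>x\<bar> + \<bar>y\<bar> + \<bar>z\<bar>" for x y z :: real by linarith
  then have "\<bar>?R\<bar> \<le> 2 * (A * h\<^sup>2 * (1 + \<bar>e\<bar>)) + A * h\<^sup>2 * (1 + \<bar>e\<bar>) + A * h\<^sup>2 * (1 + \<bar>e\<bar>)\<^sup>2 / 2"
    by (rule order.trans) (intro add_mono 1 2 3)
  also have "\<dots> \<le> 2 * (A * h\<^sup>2 * (2 * (1 + e\<^sup>2))) + A * h\<^sup>2 * (2 * (1 + e\<^sup>2)) + A * h\<^sup>2 * (2 * (1 + e\<^sup>2)) / 2"
    by (intro add_mono mult_left_mono[OF _ Ah] mult_left_mono[of _ _ 2] divide_right_mono one_plus_abs_le(1,2)) simp_all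
  also have "\<dots> = 7 * (A * h\<^sup>2) * (1 + e\<^sup>2) ^ 1" by (simp add: algebra_simps)
  also have "\<dots> \<le> 7 * (A * h\<^sup>2) * (1 + e\<^sup>2)\<^sup>2"
    using Ah by (intro mult_left_mono power_increasing) auto
  also have "\<dots> = 7 * A * min 1 \<bar>h\<bar> * (h\<^sup>2 * (1 + e\<^sup>2)\<^sup>2)" using False by simp
  finally show ?thesis .
qed

text \<open>
  Expanding the square turns the sum into a bilinear form in \<open>u\<close>, and a bilinear form is at most its
  largest coefficient times the square of the \<open>l\<^sub>1\<close> norm.
\<close>

lemma quadratic_form_le_sup:
  fixes u :: "nat \<Rightarrow> real" and x :: "nat \<Rightarrow> nat \<Rightarrow> real"
  assumes "\<And>j k. j < p \<Longrightarrow> k < p \<Longrightarrow> ennreal \<bar>\<Sum>i<n. x i j * x i k * \<xi> i\<bar> \<le> G"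
  shows "ennreal \<bar>\<Sum>i<n. (\<Sum>j<p. x i j * u j)\<^sup>2 * \<xi> i\<bar> \<le> ennreal ((\<Sum>j<p. \<bar>u j\<bar>)\<^sup>2) * G"
proof -
  let ?T = "\<lambda>j k. \<Sum>i<n. x i j * x i k * \<xi> i"
  have "(\<Sum>i<n. (\<Sum>j<p. x i j * u j)\<^sup>2 * \<xi> i) = (\<Sum>i<n. \<Sum>j<p. \<Sum>k<p. u j * u k * (x i j * x i k * \<xi> i))"
    by (simp add: power2_eq_square sum_product sum_distrib_right sum_distrib_left mult_ac)
  also have "\<dots> = (\<Sum>j<p. \<Sum>i<n. \<Sum>k<p. u j * u k * (x i j * x i k * \<xi> i))"
    by (rule sum.swap)
  also have "\<dots> = (\<Sum>j<p. \<Sum>k<p. \<Sum>i<n. u j * u k * (x i j * x i k * \<xi> i))"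
    by (intro sum.cong refl sum.swap)
  also have "\<dots> = (\<Sum>j<p. \<Sum>k<p. u j * u k * ?T j k)"
    by (simp add: sum_distrib_left)
  finally have eq: "(\<Sum>i<n. (\<Sum>j<p. x i j * u j)\<^sup>2 * \<xi> i) = (\<Sum>j<p. \<Sum>k<p. u j * u k * ?T j k)" .
  have "\<bar>\<Sum>j<p. \<Sum>k<p. u j * u k * ?T j k\<bar> \<le> (\<Sum>j<p. \<Sum>k<p. \<bar>u j\<bar> * \<bar>u k\<bar> * \<bar>?T j k\<bar>)"
    by (intro order.trans[OF sum_abs] sum_mono order.trans[OF sum_abs]) (simp add: abs_mult)
  then have "ennreal \<bar>\<Sum>i<n. (\<Sum>j<p. x i j * u j)\<^sup>2 * \<xi> i\<bar> \<le> ennreal (\<Sum>j<p. \<Sum>k<p. \<bar>u j\<bar> * \<bar>u k\<bar> * \<bar>?T j k\<bar>)"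
    unfolding eq by (rule ennreal_leI)
  also have "\<dots> = (\<Sum>j<p. \<Sum>k<p. ennreal (\<bar>u j\<bar> * \<bar>u k\<bar>) * ennreal \<bar>?T j k\<bar>)"
    by (simp add: sum_ennreal[symmetric] ennreal_mult sum_nonneg del: sum_ennreal)
  also have "\<dots> \<le> (\<Sum>j<p. \<Sum>k<p. ennreal (\<bar>u j\<bar> * \<bar>u k\<bar>) * G)"
    using assms by (intro sum_mono mult_left_mono) auto
  also have "\<dots> = ennreal (\<Sum>j<p. \<Sum>k<p. \<bar>u j\<bar> * \<bar>u k\<bar>) * G"
    by (simp add: sum_distrib_right[symmetric] sum_nonneg)
  also have "(\<Sum>j<p. \<Sum>k<p. \<bar>u j\<bar> * \<bar>u k\<bar>) = (\<Sum>j<p. \<bar>u j\<bar>)\<^sup>2"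
    by (simp add: power2_eq_square sum_product)
  finally show ?thesis .
qed

text \<open>
  The left inverse of the map from errors to data in \<open>data_law\<close>. The restriction to \<open>{..<dim_row X}\<close> keeps
  the result in the space of the product measure, whose points are extensional functions.
\<close>

definition residuals :: "real mat \<Rightarrow> real vec \<Rightarrow> (nat \<Rightarrow> real) \<Rightarrow> nat \<Rightarrow> real" where
  "residuals X \<theta> Y = (\<lambda>i\<in>{..<dim_row X}. Y i - row X i \<bullet> \<theta>)"

context tame_error
begin

lemma measurable_residuals [measurable]:
  "residuals X \<theta> \<in> measurable (PiM {..<dim_row X} (\<lambda>_. borel)) (PiM {..<dim_row X} (\<lambda>_. error_law \<eta>0))"
  unfolding residuals_def by measurable

lemma measurable_data_map [measurable]:
  "(\<lambda>e. \<lambda>i\<in>{..<dim_row X}. row X i \<bullet> \<theta> + e i)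
    \<in> measurable (PiM {..<dim_row X} (\<lambda>_. error_law \<eta>0)) (PiM {..<dim_row X} (\<lambda>_. borel))"
  by measurable

lemma residuals_data_map:
  assumes "e \<in> space (PiM {..<dim_row X} (\<lambda>_. error_law \<eta>0))"
  shows "residuals X \<theta> (\<lambda>i\<in>{..<dim_row X}. row X i \<bullet> \<theta> + e i) = e"
  using assms by (auto simp: residuals_def space_PiM PiE_def extensional_def fun_eq_iff)

lemma nn_integral_data_law:
  assumes "G \<in> borel_measurable (PiM {..<dim_row X} (\<lambda>_. error_law \<eta>0))"
  shows "(\<integral>\<^sup>+Y. G (residuals X \<theta> Y) \<partial>data_law X \<theta> \<eta>0) = (\<integral>\<^sup>+e. G e \<partial>PiM {..<dim_row X} (\<lambda>_. error_law \<eta>0))"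
  unfolding data_law_def
  by (subst nn_integral_distr[OF measurable_data_map])
     (use measurable_compose[OF measurable_residuals assms] in
       \<open>auto simp: residuals_data_map cong: nn_integral_cong\<close>)

lemma integral_data_law_coordinate:
  fixes f :: "real \<Rightarrow> real"
  assumes f [measurable]: "f \<in> borel_measurable borel" and i: "i < dim_row X"
  shows "(\<integral>Y. f (Y i - row X i \<bullet> \<theta>) \<partial>data_law X \<theta> \<eta>0) = (\<integral>x. f x \<partial>error_law \<eta>0)"
proof -
  let ?P = "PiM {..<dim_row X} (\<lambda>_. error_law \<eta>0)"
  interpret P: product_prob_space "\<lambda>_::nat. error_law \<eta>0" "{..<dim_row X}" by unfold_locales
  have i': "i \<in> {..<dim_row X}" using i by simp
  have "(\<integral>Y. f (Y i - row X i \<bullet> \<theta>) \<partial>data_law X \<theta> \<eta>0) = (\<integral>e. f (e i) \<partial>?P)"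
    unfolding data_law_def
  proof (subst integral_distr[OF measurable_data_map])
    have [measurable]: "(\<lambda>Y. Y i) \<in> measurable (PiM {..<dim_row X} (\<lambda>_. borel)) borel"
      using i' by (rule measurable_component_singleton)
    show "(\<lambda>Y. f (Y i - row X i \<bullet> \<theta>)) \<in> borel_measurable (PiM {..<dim_row X} (\<lambda>_. borel))"
      by measurable
  qed (use i' in simp)
  also have "\<dots> = (\<integral>x. f x \<partial>distr ?P (error_law \<eta>0) (\<lambda>e. e i))"
    using i' by (subst integral_distr) auto
  also have "distr ?P (error_law \<eta>0) (\<lambda>e. e i) = error_law \<eta>0"
    using i' by (rule P.PiM_component)
  finally show ?thesis .
qed

text \<open>
  The centring in the empirical process is void because the score has mean zero; the powers of the
  sample size cancel.
\<close>

lemma scalar_prod_emp_proc_score: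
  assumes X: "X \<in> carrier_mat n p" and n: "0 < n" and \<theta>0: "\<theta>0 \<in> carrier_vec p" and u: "u \<in> carrier_vec p"
    and \<eta>: "tame_density A \<eta>"
  shows "sqrt n * (u \<bullet> emp_proc_vec X (data_law X \<theta>0 \<eta>0) (score \<theta>0 \<eta>) Y)
     = (\<Sum>i<n. (row X i \<bullet> u) * ell_dot \<eta> (Y i - row X i \<bullet> \<theta>0))"
proof -
  have dims [simp]: "dim_row X = n" "dim_col X = p" using X by auto
  have "log_deriv \<eta> 1 \<in> borel_measurable borel"
    by (rule borel_measurable_continuous_onI[OF continuous_log_deriv[OF \<eta>]]) simp
  then have meas: "ell_dot \<eta> \<in> borel_measurable borel"
    by (simp add: ell_dot_eq[abs_def])
  have mean: "(\<integral>Y'. ell_dot \<eta> (Y' i - row X i \<bullet> \<theta>0) \<partial>data_law X \<theta>0 \<eta>0) = 0" if "i < n" for i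
    using integral_data_law_coordinate[OF meas, of i X \<theta>0] integral_score_zero[OF \<eta>] that by simp
  have comp: "score \<theta>0 \<eta> (row X i) y $ j = ell_dot \<eta> (y - row X i \<bullet> \<theta>0) * row X i $ j" if "j < p" for i y j
    using that by (simp add: score_def)
  have emp: "emp_proc X (data_law X \<theta>0 \<eta>0) (\<lambda>x y. score \<theta>0 \<eta> x y $ j) Y
      = 1 / sqrt n * (\<Sum>i<n. ell_dot \<eta> (Y i - row X i \<bullet> \<theta>0) * row X i $ j)" if "j < p" for j
    unfolding emp_proc_def using mean that by (simp add: comp)
  have "sqrt n * (u \<bullet> emp_proc_vec X (data_law X \<theta>0 \<eta>0) (score \<theta>0 \<eta>) Y)
      = sqrt n * (\<Sum>j<p. u $ j * (1 / sqrt n * (\<Sum>i<n. ell_dot \<eta> (Y i - row X i \<bullet> \<theta>0) * row X i $ j)))"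
    by (simp add: scalar_prod_def emp_proc_vec_def emp lessThan_atLeast0)
  also have "\<dots> = (\<Sum>j<p. \<Sum>i<n. row X i $ j * u $ j * ell_dot \<eta> (Y i - row X i \<bullet> \<theta>0))"
    using n by (simp add: sum_distrib_left mult_ac)
  also have "\<dots> = (\<Sum>i<n. \<Sum>j<p. row X i $ j * u $ j * ell_dot \<eta> (Y i - row X i \<bullet> \<theta>0))"
    by (rule sum.swap)
  also have "\<dots> = (\<Sum>i<n. (row X i \<bullet> u) * ell_dot \<eta> (Y i - row X i \<bullet> \<theta>0))"
    using u by (simp add: scalar_prod_def sum_distrib_right lessThan_atLeast0)
  finally show ?thesis .
qed

end

lemma l2_norm_mult_vec_sq:
  assumes "X \<in> carrier_mat n p"
  shows "(l2_norm (X *\<^sub>v u))\<^sup>2 = (\<Sum>i<n. (row X i \<bullet> u)\<^sup>2)"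
proof -
  have eq: "(X *\<^sub>v u) \<bullet> (X *\<^sub>v u) = (\<Sum>i<n. (row X i \<bullet> u)\<^sup>2)"
    using assms by (simp add: scalar_prod_def[of "X *\<^sub>v u"] power2_eq_square lessThan_atLeast0)
  show ?thesis unfolding l2_norm_def eq by (simp add: sum_nonneg)
qed

lemma smult_mat_mult_vec:
  assumes "B \<in> carrier_mat n p" "v \<in> carrier_vec p"
  shows "(k \<cdot>\<^sub>m B) *\<^sub>v v = k \<cdot>\<^sub>v (B *\<^sub>v (v :: real vec))"
  using assms by (intro eq_vecI) (auto simp: scalar_prod_def sum_distrib_left mult.assoc)

lemma scalar_prod_info_mat:
  assumes X: "X \<in> carrier_mat n p" and n: "0 < n" and u: "u \<in> carrier_vec p"
  shows "real n / 2 * (u \<bullet> (info_mat X \<eta>0 \<eta> *\<^sub>v u)) = info \<eta>0 \<eta> / 2 * (\<Sum>i<n. (row X i \<bullet> u)\<^sup>2)"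
proof -
  have Xu: "X *\<^sub>v u \<in> carrier_vec n" using X u by simp
  have "info_mat X \<eta>0 \<eta> *\<^sub>v u = (info \<eta>0 \<eta> * (1 / real n)) \<cdot>\<^sub>v (transpose_mat X *\<^sub>v (X *\<^sub>v u))"
  proof -
    have XX: "transpose_mat X * X \<in> carrier_mat p p" using X by simp
    then have "(1 / real n) \<cdot>\<^sub>m (transpose_mat X * X) \<in> carrier_mat p p" by simp
    then have "info_mat X \<eta>0 \<eta> *\<^sub>v u = info \<eta>0 \<eta> \<cdot>\<^sub>v ((1 / real n) \<cdot>\<^sub>v ((transpose_mat X * X) *\<^sub>v u))"
      using X u XX by (simp add: info_mat_def gram_def smult_mat_mult_vec[of _ p p])
    also have "(transpose_mat X * X) *\<^sub>v u = transpose_mat X *\<^sub>v (X *\<^sub>v u)"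
      using X u by (intro assoc_mult_mat_vec[of _ p n _ p]) auto
    finally show ?thesis by (simp add: smult_smult_assoc)
  qed
  also have "u \<bullet> \<dots> = info \<eta>0 \<eta> * (1 / real n) * (u \<bullet> (transpose_mat X *\<^sub>v (X *\<^sub>v u)))"
    using X u Xu by (intro scalar_prod_smult_right) auto
  also have "u \<bullet> (transpose_mat X *\<^sub>v (X *\<^sub>v u)) = (transpose_mat X *\<^sub>v (X *\<^sub>v u)) \<bullet> u"
    using X u by (intro comm_scalar_prod[of _ p]) auto
  also have "\<dots> = (X *\<^sub>v u) \<bullet> (X *\<^sub>v u)"
    by (rule transpose_vec_mult_scalar[OF X u Xu])
  also have "\<dots> = (\<Sum>i<n. (row X i \<bullet> u)\<^sup>2)"
    using X by (simp add: scalar_prod_def[of "X *\<^sub>v u"] power2_eq_square lessThan_atLeast0)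
  finally show ?thesis using n by simp
qed

section \<open>Expectation of the remainder\<close>

lemma row_scalar_prod:
  assumes "X \<in> carrier_mat n p" "i < n" "u \<in> carrier_vec p"
  shows "row X i \<bullet> u = (\<Sum>j<p. X $$ (i, j) * u $ j)"
  using assms by (simp add: scalar_prod_def lessThan_atLeast0)

lemma sum_mult_centered:
  fixes a b :: "'i \<Rightarrow> real"
  shows "(\<Sum>i\<in>I. a i * (b i - c)) = (\<Sum>i\<in>I. a i * b i) - c * (\<Sum>i\<in>I. a i)"
  unfolding right_diff_distrib sum_subtractf sum_distrib_left by (simp add: mult.commute)

context tame_error
begin

text \<open>
  The information term enters with the mean of the second logarithmic derivative by
  \<open>integral_second_log_deriv\<close>, so it centres the second-order term of the expansion.
\<close>

lemma LAN_remainder_eq: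
  fixes Y :: "nat \<Rightarrow> real"
  assumes X: "X \<in> carrier_mat n p" and n: "0 < n"
    and \<theta>0: "\<theta>0 \<in> carrier_vec p" and \<theta>: "\<theta> \<in> carrier_vec p" and \<eta>: "tame_density A \<eta>"
  defines "h \<equiv> \<lambda>i. row X i \<bullet> (\<theta> - \<theta>0)" and "e \<equiv> residuals X \<theta>0 Y"
  shows "LAN_remainder X \<theta>0 \<eta>0 Y \<theta> \<eta> =
    (\<Sum>i<n. ell \<eta> (e i - h i) - ell \<eta> (e i) + h i * log_deriv \<eta> 1 (e i) - (h i)\<^sup>2 / 2 * log_deriv \<eta> 2 (e i))
    + 1 / 2 * (\<Sum>i<n. (h i)\<^sup>2 * (log_deriv \<eta> 2 (e i) - (\<integral>x. log_deriv \<eta> 2 x \<partial>error_law \<eta>0)))"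
proof -
  have dim [simp]: "dim_row X = n" using X by simp
  have u: "\<theta> - \<theta>0 \<in> carrier_vec p" using \<theta> \<theta>0 by simp
  have e: "e i = Y i - row X i \<bullet> \<theta>0" if "i < n" for i
    using that by (simp add: e_def residuals_def)
  have shift: "Y i - row X i \<bullet> \<theta> = e i - h i" if "i < n" for i
  proof -
    have "row X i \<bullet> (\<theta> - \<theta>0) = row X i \<bullet> \<theta> - row X i \<bullet> \<theta>0"
      using X \<theta> \<theta>0 by (intro scalar_prod_minus_distrib[of _ p]) auto
    then show ?thesis using e[OF that] by (simp add: h_def)
  qed
  have "total_loglik X Y \<theta> \<eta> - total_loglik X Y \<theta>0 \<eta> = (\<Sum>i<n. ell \<eta> (e i - h i) - ell \<eta> (e i))"
    unfolding total_loglik_def loglik_def dim by (simp add: shift e sum_subtractf)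
  moreover have "sqrt (real n) * ((\<theta> - \<theta>0) \<bullet> emp_proc_vec X (data_law X \<theta>0 \<eta>0) (score \<theta>0 \<eta>) Y)
      = - (\<Sum>i<n. h i * log_deriv \<eta> 1 (e i))"
    unfolding scalar_prod_emp_proc_score[OF X n \<theta>0 u \<eta>]
    by (simp add: ell_dot_eq e h_def sum_negf)
  moreover have "real n / 2 * ((\<theta> - \<theta>0) \<bullet> (info_mat X \<eta>0 \<eta> *\<^sub>v (\<theta> - \<theta>0)))
      = info \<eta>0 \<eta> / 2 * (\<Sum>i<n. (h i)\<^sup>2)"
    unfolding scalar_prod_info_mat[OF X n u] by (simp add: h_def)
  moreover have "1 / 2 * (\<Sum>i<n. (h i)\<^sup>2 * (log_deriv \<eta> 2 (e i) - (\<integral>x. log_deriv \<eta> 2 x \<partial>error_law \<eta>0)))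
      = (\<Sum>i<n. (h i)\<^sup>2 / 2 * log_deriv \<eta> 2 (e i)) + info \<eta>0 \<eta> / 2 * (\<Sum>i<n. (h i)\<^sup>2)"
    unfolding sum_mult_centered integral_second_log_deriv[OF \<eta>]
    by (simp add: sum_divide_distrib[symmetric] add_divide_distrib)
  ultimately show ?thesis
    unfolding LAN_remainder_def dim sum.distrib sum_subtractf by linarith
qed

abbreviation design_deviation :: "real mat \<Rightarrow> (nat \<Rightarrow> real) \<Rightarrow> ennreal" where
  "design_deviation X \<equiv> sup_deviation (dim_row X) ({..<dim_col X} \<times> {..<dim_col X})
     (\<lambda>(j, k) i. X $$ (i, j) * X $$ (i, k))"

lemma quadratic_form_deviation:
  fixes f f' :: "real \<Rightarrow> real"
  assumes X: "X \<in> carrier_mat n p" and u: "u \<in> carrier_vec p"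
    and der: "\<And>x. (f has_real_derivative f' x) (at x)" and cont: "continuous_on UNIV f'"
    and growth: "\<And>x. \<bar>f' x\<bar> \<le> B * (1 + x\<^sup>2)\<^sup>2" and int: "integrable (error_law \<eta>0) f" and B: "0 \<le> B"
  shows "ennreal \<bar>\<Sum>i<n. (row X i \<bullet> u)\<^sup>2 * (f (e i) - (\<integral>x. f x \<partial>error_law \<eta>0))\<bar>
    \<le> ennreal ((l1_norm u)\<^sup>2) * (ennreal B * design_deviation X e)"
proof -
  have dims: "dim_row X = n" "dim_col X = p" using X by auto
  have "ennreal \<bar>\<Sum>i<n. X $$ (i, j) * X $$ (i, k) * (f (e i) - (\<integral>x. f x \<partial>error_law \<eta>0))\<bar>
      \<le> ennreal B * design_deviation X e" if "j < p" "k < p" for j k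
  proof -
    let ?a = "\<lambda>(j, k) i. X $$ (i, j) * X $$ (i, k)"
    have "ennreal \<bar>\<Sum>i<n. ?a (j, k) i * (f (e i) - (\<integral>x. f x \<partial>error_law \<eta>0))\<bar>
       \<le> ennreal B * (\<integral>\<^sup>+t. ennreal ((1 + t\<^sup>2)\<^sup>2) * ennreal \<bar>tail_deviation n (?a (j, k)) t e\<bar> \<partial>lborel)"
      by (rule centered_sum_le_tail_deviation[OF der cont growth int B])
    also have "\<dots> \<le> ennreal B * design_deviation X e"
      unfolding dims using that by (intro mult_left_mono sup_deviation_upper) auto
    finally show ?thesis by simp
  qed
  from quadratic_form_le_sup[where p=p and u="\<lambda>j. u $ j", OF this]
  show ?thesis using u by (simp add: row_scalar_prod[OF X _ u] l1_norm_def)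
qed

text \<open>
  A bound for each realization of the data, in which \<open>\<eta>\<close> does not occur on the right and \<open>\<theta>\<close> occurs only
  through the prediction error. Of the constant \<open>30 * A\<close>, the second-order term contributes \<open>2 * A\<close> and
  the fluctuation of the third-order terms \<open>28 * A\<close>. The mean of the third-order terms contributes the
  summand with the prediction error.
\<close>

lemma LAN_remainder_bound:
  assumes X: "X \<in> carrier_mat n p" and n: "0 < n"
    and L: "\<And>i j. i < n \<Longrightarrow> j < p \<Longrightarrow> \<bar>X $$ (i, j)\<bar> \<le> L" "0 \<le> L"
    and \<theta>0: "\<theta>0 \<in> carrier_vec p" and \<theta>: "\<theta> \<in> carrier_vec p" and \<eta>: "tame_density A \<eta>"
    and \<epsilon>: "l1_norm (\<theta> - \<theta>0) \<le> \<epsilon>"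
  shows "ennreal \<bar>LAN_remainder X \<theta>0 \<eta>0 Y \<theta> \<eta>\<bar>
    \<le> ennreal (30 * A * \<epsilon>\<^sup>2) * design_deviation X (residuals X \<theta>0 Y)
      + ennreal (7 * pi * A\<^sup>2 * L * \<epsilon>) * ennreal ((l2_norm (X *\<^sub>v (\<theta> - \<theta>0)))\<^sup>2)"
proof -
  define u where "u = \<theta> - \<theta>0"
  define h where "h i = row X i \<bullet> u" for i
  define e where "e = residuals X \<theta>0 Y"
  define G where "G = design_deviation X e"
  define w where "w x = (1 + x\<^sup>2)\<^sup>2" for x :: real
  define Q where "Q = (\<integral>x. w x \<partial>error_law \<eta>0)"
  define H where "H = (\<Sum>i<n. (h i)\<^sup>2)"
  define T1 where "T1 = \<bar>\<Sum>i<n. (h i)\<^sup>2 * (log_deriv \<eta> 2 (e i) - (\<integral>x. log_deriv \<eta> 2 x \<partial>error_law \<eta>0))\<bar>"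
  define T2 where "T2 = \<bar>\<Sum>i<n. (h i)\<^sup>2 * (w (e i) - Q)\<bar>"
  have u: "u \<in> carrier_vec p" using \<theta> \<theta>0 by (simp add: u_def)
  have A0: "0 \<le> A" by (rule tame_density_nonneg_const[OF tame])
  have l1: "0 \<le> l1_norm u" by (simp add: l1_norm_def sum_nonneg)
  have \<epsilon>0: "0 \<le> \<epsilon>" using l1 \<epsilon> by (simp add: u_def)
  have h_le: "\<bar>h i\<bar> \<le> L * \<epsilon>" if "i < n" for i
  proof -
    have "\<bar>h i\<bar> \<le> (\<Sum>j<p. \<bar>X $$ (i, j)\<bar> * \<bar>u $ j\<bar>)"
      unfolding h_def row_scalar_prod[OF X that u] abs_mult[symmetric] by (rule sum_abs)
    also have "\<dots> \<le> (\<Sum>j<p. L * \<bar>u $ j\<bar>)"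
      using L(1)[OF that] by (intro sum_mono mult_right_mono) auto
    also have "\<dots> = L * l1_norm u" using u by (simp add: l1_norm_def sum_distrib_left)
    also have "\<dots> \<le> L * \<epsilon>" using \<epsilon> L(2) by (intro mult_left_mono) (simp_all add: u_def)
    finally show ?thesis .
  qed
  have w_pos: "0 \<le> w x" for x by (simp add: w_def)
  have w_growth: "\<bar>w x\<bar> \<le> 1 * (1 + x\<^sup>2) ^ 7" for x
    by (simp add: w_def abs_of_nonneg power_increasing)
  have w_meas: "w \<in> borel_measurable borel" unfolding w_def by measurable
  have w_int: "integrable (error_law \<eta>0) w" by (rule integrable_error_law[OF w_meas w_growth])
  have Q: "Q \<le> A * pi"
    using integral_error_law_le[OF w_meas w_growth] by (simp add: Q_def)

  \<comment> \<open>The factor \<open>min 1 \<bar>h i\<bar>\<close> is used as \<open>L * \<epsilon>\<close> for the mean and as 1 for the fluctuation.\<close>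
  let ?m = "min 1 (L * \<epsilon>)"
  have m: "0 \<le> ?m" "?m \<le> 1" "?m \<le> L * \<epsilon>" using L(2) \<epsilon>0 by auto
  let ?R = "\<lambda>i. ell \<eta> (e i - h i) - ell \<eta> (e i) + h i * log_deriv \<eta> 1 (e i) - (h i)\<^sup>2 / 2 * log_deriv \<eta> 2 (e i)"
  have "\<bar>\<Sum>i<n. ?R i\<bar> \<le> (\<Sum>i<n. \<bar>?R i\<bar>)" by (rule sum_abs)
  also have "\<dots> \<le> (\<Sum>i<n. 7 * A * ?m * ((h i)\<^sup>2 * w (e i)))"
  proof (rule sum_mono)
    fix i assume "i \<in> {..<n}"
    then have "min 1 \<bar>h i\<bar> \<le> ?m" using h_le[of i] by auto
    then have "7 * A * min 1 \<bar>h i\<bar> * ((h i)\<^sup>2 * w (e i)) \<le> 7 * A * ?m * ((h i)\<^sup>2 * w (e i))"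
      using A0 w_pos by (intro mult_right_mono mult_left_mono) auto
    then show "\<bar>?R i\<bar> \<le> 7 * A * ?m * ((h i)\<^sup>2 * w (e i))"
      using log_density_taylor[OF \<eta>, of "e i" "h i"] unfolding w_def by linarith
  qed
  also have "\<dots> = 7 * A * ?m * (Q * H + (\<Sum>i<n. (h i)\<^sup>2 * (w (e i) - Q)))"
  proof -
    have "(\<Sum>i<n. (h i)\<^sup>2 * (w (e i) - Q)) = (\<Sum>i<n. (h i)\<^sup>2 * w (e i)) - Q * H"
      unfolding H_def by (rule sum_mult_centered)
    then have "(\<Sum>i<n. (h i)\<^sup>2 * w (e i)) = Q * H + (\<Sum>i<n. (h i)\<^sup>2 * (w (e i) - Q))" by simp
    then show ?thesis by (simp only: sum_distrib_left[symmetric])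
  qed
  also have "\<dots> \<le> 7 * A * ?m * (A * pi * H + T2)"
  proof (intro mult_left_mono add_mono)
    show "Q * H \<le> A * pi * H" using Q by (intro mult_right_mono) (simp_all add: H_def sum_nonneg)
  qed (use A0 m in \<open>simp_all add: T2_def\<close>)
  also have "\<dots> = 7 * A * (A * pi) * (?m * H) + 7 * A * (?m * T2)" by (simp add: algebra_simps)
  also have "\<dots> \<le> 7 * A * (A * pi) * (L * \<epsilon> * H) + 7 * A * (1 * T2)"
    using A0 m by (intro add_mono mult_left_mono mult_right_mono) (auto simp: H_def T2_def sum_nonneg)
  finally have R: "\<bar>\<Sum>i<n. ?R i\<bar> \<le> 7 * pi * A\<^sup>2 * L * \<epsilon> * H + 7 * A * T2"
    by (simp add: power2_eq_square mult_ac)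
  have "\<bar>LAN_remainder X \<theta>0 \<eta>0 Y \<theta> \<eta>\<bar> \<le> \<bar>\<Sum>i<n. ?R i\<bar> + 1 / 2 * T1"
    unfolding LAN_remainder_eq[OF X n \<theta>0 \<theta> \<eta>] T1_def h_def e_def u_def
    by (rule order.trans[OF abs_triangle_ineq]) (simp add: abs_mult)
  with R have "\<bar>LAN_remainder X \<theta>0 \<eta>0 Y \<theta> \<eta>\<bar> \<le> 1 / 2 * T1 + 7 * A * T2 + 7 * pi * A\<^sup>2 * L * \<epsilon> * H"
    by linarith
  then have "ennreal \<bar>LAN_remainder X \<theta>0 \<eta>0 Y \<theta> \<eta>\<bar> \<le> ennreal (1 / 2 * T1 + 7 * A * T2 + 7 * pi * A\<^sup>2 * L * \<epsilon> * H)"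
    by (rule ennreal_leI)
  also have "\<dots> = ennreal (1 / 2) * ennreal T1 + ennreal (7 * A) * ennreal T2 + ennreal (7 * pi * A\<^sup>2 * L * \<epsilon>) * ennreal H"
  proof -
    have nn: "0 \<le> T1" "0 \<le> T2" "0 \<le> H" by (simp_all add: T1_def T2_def H_def sum_nonneg)
    have cc: "0 \<le> (1 / 2 :: real)" "0 \<le> 7 * A" "0 \<le> 7 * pi * A\<^sup>2 * L * \<epsilon>" using A0 L(2) \<epsilon>0 by simp_all
    note prods = mult_nonneg_nonneg[OF cc(1) nn(1)] mult_nonneg_nonneg[OF cc(2) nn(2)] mult_nonneg_nonneg[OF cc(3) nn(3)]
    show ?thesis
      by (simp only: ennreal_plus[OF add_nonneg_nonneg[OF prods(1,2)] prods(3)] ennreal_plus[OF prods(1,2)]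
          ennreal_mult[OF cc(1) nn(1)] ennreal_mult[OF cc(2) nn(2)] ennreal_mult[OF cc(3) nn(3)])
  qed
  also have "\<dots> \<le> ennreal (1 / 2) * (ennreal (\<epsilon>\<^sup>2) * (ennreal (4 * A) * G))
      + ennreal (7 * A) * (ennreal (\<epsilon>\<^sup>2) * (ennreal 4 * G)) + ennreal (7 * pi * A\<^sup>2 * L * \<epsilon>) * ennreal H"
  proof -
    have sq: "ennreal ((l1_norm u)\<^sup>2) \<le> ennreal (\<epsilon>\<^sup>2)"
      using l1 \<epsilon> by (intro ennreal_leI power_mono) (simp_all add: u_def)
    have t1: "ennreal T1 \<le> ennreal ((l1_norm u)\<^sup>2) * (ennreal (4 * A) * G)"
      unfolding T1_def h_def G_def
    proof (rule quadratic_form_deviation[OF X u])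
      show "(log_deriv \<eta> 2 has_real_derivative log_deriv \<eta> 3 x) (at x)" for x
        using tame_densityD(5)[OF \<eta>, of 2 x] by (simp add: eval_nat_numeral)
      show "continuous_on UNIV (log_deriv \<eta> 3)" by (rule tame_densityD(6)[OF \<eta>])
      show "\<bar>log_deriv \<eta> 3 x\<bar> \<le> 4 * A * (1 + x\<^sup>2)\<^sup>2" for x
        using order.trans[OF tame_densityD(7)[OF \<eta>, of 3 x] mult_left_mono[OF one_plus_abs_le(3)[of x] A0]]
        by (simp add: mult_ac)
      show "integrable (error_law \<eta>0) (log_deriv \<eta> 2)"
      proof (rule integrable_error_law)
        show "log_deriv \<eta> 2 \<in> borel_measurable borel"
          by (rule borel_measurable_continuous_onI[OF continuous_log_deriv[OF \<eta>]]) simp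
        fix x
        have "\<bar>log_deriv \<eta> 2 x\<bar> \<le> A * (2 * (1 + x\<^sup>2))"
          using order.trans[OF tame_densityD(7)[OF \<eta>, of 2 x] mult_left_mono[OF one_plus_abs_le(2)[of x] A0]] by simp
        also have "\<dots> = 2 * A * (1 + x\<^sup>2) ^ 1" by simp
        also have "\<dots> \<le> 2 * A * (1 + x\<^sup>2) ^ 7" using A0 by (intro mult_left_mono power_increasing) auto
        finally show "\<bar>log_deriv \<eta> 2 x\<bar> \<le> 2 * A * (1 + x\<^sup>2) ^ 7" .
      qed
    qed (use A0 in simp)
    have t2: "ennreal T2 \<le> ennreal ((l1_norm u)\<^sup>2) * (ennreal 4 * G)"
      unfolding T2_def h_def G_def Q_def
    proof (rule quadratic_form_deviation[OF X u])
      show "(w has_real_derivative 4 * x * (1 + x\<^sup>2)) (at x)" for x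
        unfolding w_def by (auto intro!: derivative_eq_intros)
      show "continuous_on UNIV (\<lambda>x::real. 4 * x * (1 + x\<^sup>2))" by (intro continuous_intros)
      show "\<bar>4 * x * (1 + x\<^sup>2)\<bar> \<le> 4 * (1 + x\<^sup>2)\<^sup>2" for x :: real
      proof -
        have "0 \<le> (\<bar>x\<bar> - 1)\<^sup>2" by simp
        then have "2 * \<bar>x\<bar> \<le> 1 + x\<^sup>2" by (simp add: power2_eq_square algebra_simps)
        then have "\<bar>x\<bar> \<le> 1 + x\<^sup>2" by linarith
        then have "4 * (\<bar>x\<bar> * (1 + x\<^sup>2)) \<le> 4 * ((1 + x\<^sup>2) * (1 + x\<^sup>2))" by (intro mult_left_mono mult_right_mono) auto
        then show ?thesis by (simp add: abs_mult abs_of_nonneg power2_eq_square[of "1 + x\<^sup>2"])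
      qed
    qed (use w_int in simp_all)
    note mono = mult_left_mono[OF order.trans[OF _ mult_right_mono[OF sq zero_le]] zero_le]
    show ?thesis by (rule add_mono[OF add_mono[OF mono[OF t1] mono[OF t2]] order.refl])
  qed
  also have "ennreal (1 / 2) * (ennreal (\<epsilon>\<^sup>2) * (ennreal (4 * A) * G)) + ennreal (7 * A) * (ennreal (\<epsilon>\<^sup>2) * (ennreal 4 * G))
      = ennreal (30 * A * \<epsilon>\<^sup>2) * G"
  proof -
    have prod: "ennreal a * (ennreal b * (ennreal c * G)) = ennreal (a * (b * c)) * G"
      if "0 \<le> a" "0 \<le> b" "0 \<le> c" for a b c
      using that by (simp only: ennreal_mult mult_nonneg_nonneg mult.assoc)
    have "ennreal (1 / 2) * (ennreal (\<epsilon>\<^sup>2) * (ennreal (4 * A) * G)) + ennreal (7 * A) * (ennreal (\<epsilon>\<^sup>2) * (ennreal 4 * G))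
        = (ennreal (1 / 2 * (\<epsilon>\<^sup>2 * (4 * A))) + ennreal (7 * A * (\<epsilon>\<^sup>2 * 4))) * G"
      using A0 by (subst (1 2) prod) (simp_all only: distrib_right mult_nonneg_nonneg zero_le_power2 zero_le_numeral zero_le_divide_1_iff)
    also have "ennreal (1 / 2 * (\<epsilon>\<^sup>2 * (4 * A))) + ennreal (7 * A * (\<epsilon>\<^sup>2 * 4))
        = ennreal (1 / 2 * (\<epsilon>\<^sup>2 * (4 * A)) + 7 * A * (\<epsilon>\<^sup>2 * 4))"
      using A0 by (intro ennreal_plus[symmetric]) simp_all
    also have "1 / 2 * (\<epsilon>\<^sup>2 * (4 * A)) + 7 * A * (\<epsilon>\<^sup>2 * 4) = 30 * A * \<epsilon>\<^sup>2" by simp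
    finally show ?thesis .
  qed
  finally show ?thesis
    unfolding l2_norm_mult_vec_sq[OF X] G_def H_def h_def e_def u_def .
qed

text \<open>
  The supremum over uncountably many \<open>\<theta>\<close> and \<open>\<eta>\<close> need not be measurable, but it lies below the
  measurable majorant of \<open>LAN_remainder_bound\<close>, to which monotonicity of the integral and
  \<open>expected_sup_deviation\<close> apply. The supremum of the prediction errors is deterministic and passes
  through the integral.
\<close>

lemma expected_LAN_remainder:
  assumes X: "X \<in> carrier_mat n p" and n: "0 < n" and p: "2 \<le> p"
    and L: "\<And>i j. i < n \<Longrightarrow> j < p \<Longrightarrow> \<bar>X $$ (i, j)\<bar> \<le> L" "0 < L"
    and \<theta>0: "\<theta>0 \<in> carrier_vec p" and s: "0 < s"
    and \<Theta>: "\<And>\<theta>. \<theta> \<in> \<Theta> \<Longrightarrow> \<theta> \<in> carrier_vec p \<and> l1_norm (\<theta> - \<theta>0) \<le> \<epsilon>"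
    and \<H>: "\<And>\<eta>. \<eta> \<in> \<H> \<Longrightarrow> tame_density A \<eta>"
    and C: "240 * pi * sqrt (A * pi) * A * L\<^sup>2 \<le> C" "7 * pi * A\<^sup>2 * L \<le> C"
  shows "(\<integral>\<^sup>+Y. (SUP \<theta>\<in>\<Theta>. SUP \<eta>\<in>\<H>. ennreal \<bar>LAN_remainder X \<theta>0 \<eta>0 Y \<theta> \<eta>\<bar>) \<partial>data_law X \<theta>0 \<eta>0)
    \<le> ennreal C * (ennreal (real n * \<epsilon>\<^sup>2 * rate n p s)
        + ennreal \<epsilon> * (SUP \<theta>\<in>\<Theta>. ennreal ((l2_norm (X *\<^sub>v (\<theta> - \<theta>0)))\<^sup>2)))"
proof (cases "\<Theta> = {}")
  case False
  then obtain \<theta>1 where "\<theta>1 \<in> \<Theta>" by blast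
  then have \<epsilon>0: "0 \<le> \<epsilon>" using \<Theta>[of \<theta>1] order.trans[of 0 "l1_norm (\<theta>1 - \<theta>0)" \<epsilon>]
    by (simp add: l1_norm_def sum_nonneg)
  have dims: "dim_row X = n" "dim_col X = p" using X by auto
  have A0: "0 \<le> A" by (rule tame_density_nonneg_const[OF tame])
  define S where "S = (SUP \<theta>\<in>\<Theta>. ennreal ((l2_norm (X *\<^sub>v (\<theta> - \<theta>0)))\<^sup>2))"
  let ?P = "PiM {..<dim_row X} (\<lambda>_. error_law \<eta>0)"
  let ?G = "design_deviation X"
  have G_meas [measurable]: "?G \<in> borel_measurable ?P"
    by (rule sup_deviation_measurable) simp
  interpret P: product_prob_space "\<lambda>_::nat. error_law \<eta>0" "{..<dim_row X}" by unfold_locales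
  have pt: "(SUP \<theta>\<in>\<Theta>. SUP \<eta>\<in>\<H>. ennreal \<bar>LAN_remainder X \<theta>0 \<eta>0 Y \<theta> \<eta>\<bar>)
     \<le> ennreal (30 * A * \<epsilon>\<^sup>2) * ?G (residuals X \<theta>0 Y) + ennreal (7 * pi * A\<^sup>2 * L * \<epsilon>) * S" for Y
  proof (intro SUP_least)
    fix \<theta> \<eta> assume \<theta>: "\<theta> \<in> \<Theta>" and \<eta>: "\<eta> \<in> \<H>"
    have "ennreal \<bar>LAN_remainder X \<theta>0 \<eta>0 Y \<theta> \<eta>\<bar>
        \<le> ennreal (30 * A * \<epsilon>\<^sup>2) * ?G (residuals X \<theta>0 Y)
          + ennreal (7 * pi * A\<^sup>2 * L * \<epsilon>) * ennreal ((l2_norm (X *\<^sub>v (\<theta> - \<theta>0)))\<^sup>2)"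
      using LAN_remainder_bound[OF X n L(1) less_imp_le[OF L(2)] \<theta>0 _ \<H>[OF \<eta>]] \<Theta>[OF \<theta>] by blast
    also have "\<dots> \<le> ennreal (30 * A * \<epsilon>\<^sup>2) * ?G (residuals X \<theta>0 Y) + ennreal (7 * pi * A\<^sup>2 * L * \<epsilon>) * S"
      unfolding S_def by (rule add_left_mono[OF mult_left_mono[OF SUP_upper[OF \<theta>] zero_le]])
    finally show "ennreal \<bar>LAN_remainder X \<theta>0 \<eta>0 Y \<theta> \<eta>\<bar>
        \<le> ennreal (30 * A * \<epsilon>\<^sup>2) * ?G (residuals X \<theta>0 Y) + ennreal (7 * pi * A\<^sup>2 * L * \<epsilon>) * S" .
  qed
  have "(\<integral>\<^sup>+Y. (SUP \<theta>\<in>\<Theta>. SUP \<eta>\<in>\<H>. ennreal \<bar>LAN_remainder X \<theta>0 \<eta>0 Y \<theta> \<eta>\<bar>) \<partial>data_law X \<theta>0 \<eta>0)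
      \<le> (\<integral>\<^sup>+Y. ennreal (30 * A * \<epsilon>\<^sup>2) * ?G (residuals X \<theta>0 Y) + ennreal (7 * pi * A\<^sup>2 * L * \<epsilon>) * S \<partial>data_law X \<theta>0 \<eta>0)"
    by (rule nn_integral_mono) (rule pt)
  also have "\<dots> = (\<integral>\<^sup>+e. ennreal (30 * A * \<epsilon>\<^sup>2) * ?G e + ennreal (7 * pi * A\<^sup>2 * L * \<epsilon>) * S \<partial>?P)"
    by (rule nn_integral_data_law) measurable
  also have "\<dots> = ennreal (30 * A * \<epsilon>\<^sup>2) * (\<integral>\<^sup>+e. ?G e \<partial>?P) + ennreal (7 * pi * A\<^sup>2 * L * \<epsilon>) * S"
    by (subst nn_integral_add, measurable, subst nn_integral_cmult, measurable) (simp add: P.emeasure_space_1)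
  also have "\<dots> \<le> ennreal (30 * A * \<epsilon>\<^sup>2) * ennreal (8 * pi * sqrt (A * pi) * L\<^sup>2 * (real n * rate n p s))
      + ennreal (7 * pi * A\<^sup>2 * L * \<epsilon>) * S"
  proof (intro add_right_mono mult_left_mono)
    let ?I = "{..<p} \<times> {..<p}"
    have "(\<integral>\<^sup>+e. ?G e \<partial>?P) \<le> ennreal (4 * pi * sqrt (A * pi) * L\<^sup>2 * sqrt (real n * ln (2 * card ?I)))"
      unfolding dims
    proof (rule expected_sup_deviation)
      have "(0, 0) \<in> ?I" using p by simp
      then show "?I \<noteq> {}" by blast
      show "\<bar>(case m of (j, k) \<Rightarrow> \<lambda>i. X $$ (i, j) * X $$ (i, k)) i\<bar> \<le> L\<^sup>2" if mI: "m \<in> ?I" and i: "i < n" for m i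
      proof -
        obtain j k where m: "m = (j, k)" "j < p" "k < p" using mI by auto
        have "\<bar>X $$ (i, j)\<bar> * \<bar>X $$ (i, k)\<bar> \<le> L * L"
          using m i L by (intro mult_mono) auto
        then show ?thesis by (simp add: m abs_mult power2_eq_square)
      qed
    qed (use L(2) in auto)
    also have "\<dots> \<le> ennreal (4 * pi * sqrt (A * pi) * L\<^sup>2 * (2 * (real n * rate n p s)))"
    proof (intro ennreal_leI mult_left_mono)
      have lnp: "0 \<le> ln (real p)" using p by simp
      \<comment> \<open>\<open>2 * p\<^sup>2 \<le> p ^ 3\<close> because \<open>2 \<le> p\<close>; a factor \<open>s \<ge> 1\<close> is then inserted\<close>
      have "2 * real (card ?I) \<le> real p ^ 3"
        using p by (simp add: power3_eq_cube mult_right_mono)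
      then have "ln (2 * real (card ?I)) \<le> ln (real p ^ 3)"
        using p by (subst ln_le_cancel_iff) auto
      also have "\<dots> = 3 * ln (real p)" using p by (simp add: ln_realpow)
      also have "\<dots> \<le> 4 * (real s * ln (real p))"
        using s lnp mult_right_mono[of 1 "real s" "ln (real p)"] by simp
      finally have "real n * ln (2 * real (card ?I)) \<le> real n * (4 * (real s * ln (real p)))"
        by (rule mult_left_mono) simp
      also have "\<dots> = (2 * real n)\<^sup>2 * (real s * ln (real p) / real n)"
        using n by (simp add: power2_eq_square)
      finally have "sqrt (real n * ln (2 * real (card ?I))) \<le> sqrt ((2 * real n)\<^sup>2 * (real s * ln (real p) / real n))"
        by (rule real_sqrt_le_mono)
      also have "\<dots> = 2 * (real n * rate n p s)"
      proof -
        have "sqrt ((2 * real n)\<^sup>2 * r) = 2 * real n * sqrt r" for r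
          by (simp only: real_sqrt_mult real_sqrt_abs)
        then show ?thesis unfolding rate_def by (simp only: mult.assoc)
      qed
      finally show "sqrt (real n * ln (real (2 * card ?I))) \<le> 2 * (real n * rate n p s)" by simp
    qed (use A0 in simp)
    also have "\<dots> = ennreal (8 * pi * sqrt (A * pi) * L\<^sup>2 * (real n * rate n p s))" by (simp add: mult_ac)
    finally show "(\<integral>\<^sup>+e. ?G e \<partial>?P) \<le> ennreal (8 * pi * sqrt (A * pi) * L\<^sup>2 * (real n * rate n p s))" .
  qed simp
  also have "ennreal (30 * A * \<epsilon>\<^sup>2) * ennreal (8 * pi * sqrt (A * pi) * L\<^sup>2 * (real n * rate n p s))
      = ennreal (240 * pi * sqrt (A * pi) * A * L\<^sup>2) * ennreal (real n * \<epsilon>\<^sup>2 * rate n p s)"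
  proof -
    have "0 \<le> rate n p s" using p by (simp add: rate_def)
    then show ?thesis using A0 by (simp add: ennreal_mult[symmetric] mult_ac)
  qed
  also have "ennreal (7 * pi * A\<^sup>2 * L * \<epsilon>) * S = ennreal (7 * pi * A\<^sup>2 * L) * (ennreal \<epsilon> * S)"
    using A0 L(2) \<epsilon>0 by (simp add: ennreal_mult mult.assoc)
  also have "ennreal (240 * pi * sqrt (A * pi) * A * L\<^sup>2) * ennreal (real n * \<epsilon>\<^sup>2 * rate n p s)
      + ennreal (7 * pi * A\<^sup>2 * L) * (ennreal \<epsilon> * S)
      \<le> ennreal C * ennreal (real n * \<epsilon>\<^sup>2 * rate n p s) + ennreal C * (ennreal \<epsilon> * S)"
    using C by (intro add_mono mult_right_mono ennreal_leI) auto
  also have "\<dots> = ennreal C * (ennreal (real n * \<epsilon>\<^sup>2 * rate n p s) + ennreal \<epsilon> * S)"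
    by (simp add: distrib_left)
  finally show ?thesis by (simp only: S_def)
qed (simp add: bot_ennreal)

end

theorem theorem3p1:
  fixes \<alpha> L M \<sigma>1 \<sigma>2 :: real
  assumes "0 < \<alpha>" and "0 < L" and "0 < M" and "0 < \<sigma>1" and "\<sigma>1 < \<sigma>2"
  shows "\<exists>C>0. \<forall>(p :: nat \<Rightarrow> nat) (X :: nat \<Rightarrow> real mat) (\<theta>0 :: nat \<Rightarrow> real vec) (\<eta>0 :: real \<Rightarrow> real)
      (s :: nat \<Rightarrow> nat) (\<epsilon> :: nat \<Rightarrow> real) (\<Theta> :: nat \<Rightarrow> real vec set).
    (\<forall>n\<ge>1. real n powr \<alpha> \<le> real (p n)) \<longrightarrow>
    (\<forall>n\<ge>1. X n \<in> carrier_mat n (p n)) \<longrightarrow>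
    (\<forall>n\<ge>1. \<forall>i<n. \<forall>j<p n. \<bar>X n $$ (i, j)\<bar> \<le> L) \<longrightarrow>
    (\<forall>n\<ge>1. \<theta>0 n \<in> carrier_vec (p n)) \<longrightarrow>
    \<eta>0 \<in> mixture_class M \<sigma>1 \<sigma>2 \<longrightarrow>
    (\<forall>n\<ge>1. 0 < s n) \<longrightarrow>
    \<epsilon> \<longlonglongrightarrow> 0 \<longrightarrow>
    (\<forall>n\<ge>1. \<Theta> n \<subseteq> {\<theta> \<in> carrier_vec (p n). sparsity \<theta> \<le> s n \<and> l1_norm (\<theta> - \<theta>0 n) \<le> \<epsilon> n}) \<longrightarrow>
    (\<forall>n\<ge>1. 2 \<le> p n \<longrightarrow>
      (\<integral>\<^sup>+ Y. (SUP \<theta>\<in>\<Theta> n. SUP \<eta>\<in>mixture_class M \<sigma>1 \<sigma>2.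
          ennreal \<bar>LAN_remainder (X n) (\<theta>0 n) \<eta>0 Y \<theta> \<eta>\<bar>) \<partial>data_law (X n) (\<theta>0 n) \<eta>0)
      \<le> ennreal C *
          (ennreal (real n * (\<epsilon> n)\<^sup>2 * rate n (p n) (s n)) +
           ennreal (\<epsilon> n) * (SUP \<theta>\<in>\<Theta> n. ennreal ((l2_norm (X n *\<^sub>v (\<theta> - \<theta>0 n)))\<^sup>2))))"
  proof -
  obtain A where A: "1 \<le> A" and tame_class: "\<And>\<eta>. \<eta> \<in> mixture_class M \<sigma>1 \<sigma>2 \<Longrightarrow> tame_density A \<eta>"
    using mixture_class_tame[OF \<open>0 < \<sigma>1\<close>] by blast
  define C where "C = max (240 * pi * sqrt (A * pi) * A * L\<^sup>2) (7 * pi * A\<^sup>2 * L)"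
  have "0 < 7 * pi * A\<^sup>2 * L" using A \<open>0 < L\<close> by simp
  then have "0 < C" unfolding C_def by (rule less_le_trans) simp
  then show ?thesis
  proof (intro exI[of _ C] conjI allI impI)
    fix p :: "nat \<Rightarrow> nat" and X :: "nat \<Rightarrow> real mat" and \<theta>0 :: "nat \<Rightarrow> real vec" and \<eta>0 :: "real \<Rightarrow> real"
      and s :: "nat \<Rightarrow> nat" and \<epsilon> :: "nat \<Rightarrow> real" and \<Theta> :: "nat \<Rightarrow> real vec set" and n :: nat
    assume X: "\<forall>n\<ge>1. X n \<in> carrier_mat n (p n)"
      and L: "\<forall>n\<ge>1. \<forall>i<n. \<forall>j<p n. \<bar>X n $$ (i, j)\<bar> \<le> L"
      and \<theta>0: "\<forall>n\<ge>1. \<theta>0 n \<in> carrier_vec (p n)"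
      and \<eta>0: "\<eta>0 \<in> mixture_class M \<sigma>1 \<sigma>2"
      and s: "\<forall>n\<ge>1. 0 < s n"
      and \<Theta>: "\<forall>n\<ge>1. \<Theta> n \<subseteq> {\<theta> \<in> carrier_vec (p n). sparsity \<theta> \<le> s n \<and> l1_norm (\<theta> - \<theta>0 n) \<le> \<epsilon> n}"
      and n: "1 \<le> n" and p: "2 \<le> p n"
    interpret tame_error A \<eta>0 by unfold_locales (rule tame_class[OF \<eta>0])
    show "(\<integral>\<^sup>+ Y. (SUP \<theta>\<in>\<Theta> n. SUP \<eta>\<in>mixture_class M \<sigma>1 \<sigma>2.
          ennreal \<bar>LAN_remainder (X n) (\<theta>0 n) \<eta>0 Y \<theta> \<eta>\<bar>) \<partial>data_law (X n) (\<theta>0 n) \<eta>0)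
      \<le> ennreal C *
          (ennreal (real n * (\<epsilon> n)\<^sup>2 * rate n (p n) (s n)) +
           ennreal (\<epsilon> n) * (SUP \<theta>\<in>\<Theta> n. ennreal ((l2_norm (X n *\<^sub>v (\<theta> - \<theta>0 n)))\<^sup>2)))"
    proof (rule expected_LAN_remainder)
      show "X n \<in> carrier_mat n (p n)" "\<theta>0 n \<in> carrier_vec (p n)" "0 < s n" "0 < n" "2 \<le> p n" "0 < L"
        using X \<theta>0 s n p \<open>0 < L\<close> by auto
      show "\<bar>X n $$ (i, j)\<bar> \<le> L" if "i < n" "j < p n" for i j
        using L n that by blast
      show "\<theta> \<in> carrier_vec (p n) \<and> l1_norm (\<theta> - \<theta>0 n) \<le> \<epsilon> n" if "\<theta> \<in> \<Theta> n" for \<theta>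
        using \<Theta> n that by blast
      show "240 * pi * sqrt (A * pi) * A * L\<^sup>2 \<le> C" "7 * pi * A\<^sup>2 * L \<le> C"
        unfolding C_def by (rule max.cobounded1 max.cobounded2)+
    qed (rule tame_class)
  qed
qed


end
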